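(* Let $G$ be a graph on $n \geqslant 18$ vertices. If $e(G)>\frac{n^{2}-3n+3}{2}$, then either $G$ contains the $2$-power of a Hamilton cycle (i.e., a spanning subgraph isomorphic to $C_n^2$), or $G$ is a subgraph of one of the following three graphs on $n$ vertices: $K_{n} \backslash E(S_{n-3})$, $K_{n} \backslash E(S_{n-4} \cup S_4)$, $K_{n} \backslash E(S_{n-4} \cup K_3)$.
   Context: All graphs are finite and simple; $e(G)$ is the number of edges. $S_k$ denotes the star on $k$ vertices, $K_k$ the complete graph on $k$ vertices, and $\cup$ denotes vertex-disjoint union. For a graph $F$ with at most $n$ vertices, $K_n\backslash E(F)$ denotes the graph obtained from $K_n$ by deleting the edges of a copy of $F$ placed on (some of) its vertices. The $k$-power $H^k$ of a graph $H$ has the same vertex set as $H$, two vertices being adjacent iff their distance in $H$ is at most $k$; $C_n$ is the cycle on $n$ vertices, so $C_n^2$ is the graph on $\mathbb{Z}_n$ in which $i\sim j$ iff $i-j\in\{\pm1,\pm2\}$. *)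

theory Defs
  imports "Graph_Theory.Graph_Theory"
begin

text \<open>
  As in the Graph_Theory library, a finite simple graph is a \<^locale>\<open>pair_graph\<close>, i.e. a finite
  loop-free symmetric relation: every edge $uv$ is represented by the two arcs $(u,v)$ and $(v,u)$.
\<close>

definition edges :: "'a pair_pre_digraph \<Rightarrow> 'a set set" where
  "edges G = {{u, v} |u v. (u, v) \<in> parcs G}"

definition complete_on :: "'a set \<Rightarrow> 'a pair_pre_digraph" where
  "complete_on V = \<lparr>pverts = V, parcs = {(u, v). u \<in> V \<and> v \<in> V \<and> u \<noteq> v}\<rparr>"

abbreviation complete_graph :: "nat \<Rightarrow> nat pair_pre_digraph" where
  "complete_graph n \<equiv> complete_on {..<n}"

text \<open>The star on \<open>k\<close> vertices (so with \<open>k - 1\<close> edges), with centre \<open>0\<close>.\<close>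

definition star_graph :: "nat \<Rightarrow> nat pair_pre_digraph" where
  "star_graph k = \<lparr>pverts = {..<k},
     parcs = {(u, v). u < k \<and> v < k \<and> u \<noteq> v \<and> (u = 0 \<or> v = 0)}\<rparr>"

text \<open>This is a simple graph, the cycle $C_n$, for \<open>n \<ge> 3\<close>.\<close>

definition cycle_graph :: "nat \<Rightarrow> nat pair_pre_digraph" where
  "cycle_graph n = \<lparr>pverts = {..<n},
     parcs = {(u, v). u < n \<and> v < n \<and> (v = (u + 1) mod n \<or> u = (v + 1) mod n)}\<rparr>"

definition disjoint_union ::
    "'a pair_pre_digraph \<Rightarrow> 'b pair_pre_digraph \<Rightarrow> ('a + 'b) pair_pre_digraph" where
  "disjoint_union G H = \<lparr>pverts = pverts G <+> pverts H,
     parcs = map_prod Inl Inl ` parcs G \<union> map_prod Inr Inr ` parcs H\<rparr>"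

text \<open>The graph distance: shortest-path distance when all arcs have weight \<open>1\<close>
  (\<open>\<infinity>\<close> between different components).\<close>

definition graph_dist :: "'a pair_pre_digraph \<Rightarrow> 'a \<Rightarrow> 'a \<Rightarrow> ereal" where
  "graph_dist G u v = wf_digraph.\<mu> (with_proj G) (\<lambda>_. 1) u v"

definition graph_power :: "nat \<Rightarrow> 'a pair_pre_digraph \<Rightarrow> 'a pair_pre_digraph" where
  "graph_power k G = \<lparr>pverts = pverts G,
     parcs = {(u, v). u \<in> pverts G \<and> v \<in> pverts G \<and> u \<noteq> v \<and> graph_dist G u v \<le> ereal (real k)}\<rparr>"

definition delete_edges :: "'a pair_pre_digraph \<Rightarrow> 'a pair_pre_digraph \<Rightarrow> 'a pair_pre_digraph" where
  "delete_edges G F = \<lparr>pverts = pverts G, parcs = parcs G - parcs F\<rparr>"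

text \<open>\<open>M\<close> is $K_n \backslash E(F)$ for some placement \<open>F'\<close> of a copy of \<open>F\<close> inside $K_n$;
  the choice of \<open>F'\<close> affects \<open>M\<close> only up to isomorphism.\<close>

definition complete_minus :: "nat \<Rightarrow> 'b pair_pre_digraph \<Rightarrow> nat pair_pre_digraph \<Rightarrow> bool" where
  "complete_minus n F M \<longleftrightarrow>
     (\<exists>F' :: nat pair_pre_digraph. subgraph (with_proj F') (with_proj (complete_graph n)) \<and>
        digraph_iso (with_proj F) (with_proj F') \<and>
        M = delete_edges (complete_graph n) F')"

definition subgraph_up_to_iso :: "'a pair_pre_digraph \<Rightarrow> 'b pair_pre_digraph \<Rightarrow> bool" where
  "subgraph_up_to_iso G M \<longleftrightarrow>
     (\<exists>H :: 'b pair_pre_digraph. subgraph (with_proj H) (with_proj M) \<and>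
        digraph_iso (with_proj G) (with_proj H))"

text \<open>A spanning copy of $C_n^k$, where \<open>n\<close> is the number of vertices of \<open>G\<close>.\<close>

definition contains_power_of_ham_cycle :: "nat \<Rightarrow> 'a pair_pre_digraph \<Rightarrow> bool" where
  "contains_power_of_ham_cycle k G \<longleftrightarrow>
     (\<exists>H :: 'a pair_pre_digraph. spanning (with_proj H) (with_proj G) \<and>
        digraph_iso (with_proj (graph_power k (cycle_graph (card (pverts G))))) (with_proj H))"

end

(*
Let E be the set of edges missing from G; it has at most n - 2 elements, and we have to arrange the
vertices cyclically so that no edge of E joins two vertices at cyclic distance at most two.
A vertex x can be inserted into such an arrangement of N vertices as soon as 4 deg x < N, so we delete
vertices of small positive degree until none is left, arrange the rest by hand and insert the deleted
vertices again. For n > 18 the inductive hypothesis is the statement for n - 1; for n <= 18 deletions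
are restricted to vertices of degree at least two, which keeps the number of edges below 2n - 20.
With four isolated vertices, edges at leaves may be ignored, because a leaf can be exchanged with an
isolated vertex; in the end at most seven vertices are not isolated, and they are kept apart by isolated
ones. (The obstruction K_6 together with isolated vertices, which needs 18 vertices, shows that n = 18
is tight.) Otherwise at most four vertices are not leaves, and each is surrounded by leaves of the others.
A vertex v with at most five non-neighbours is treated separately: it needs a path a b c d in the
complement among its non-neighbours, and this fails exactly for the exceptional graphs.
*)

theory Submission
  imports Defs
begin

section \<open>Edge sets and cyclic arrangements\<close>

text \<open>The number 2n - 20 comes from n = 17, where n - 2 missing edges may form a K_6, whose
  vertices would have to be at pairwise cyclic distance at least three. The bounds n - 2 and 2n - 20
  agree at n = 18, and deleting a vertex of degree at least two preserves the second one; at n = 17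
  it leaves at most 14 edges. The price is that leaves have to stay: they are exchanged with
  isolated vertices or serve as separators between large vertices. In the order a b v c d the pairs
  at distance at most two are those with v and ab, bc, cd. With neighbours meant in E, a vertex v
  with fewer than four non-neighbours gives the first exceptional graph. Four non-neighbours span at
  most (n - 2) - (n - 5) = 3 edges of E, and the graphs with four vertices and at most three edges
  whose complement has no Hamilton path are K_{1,3} and K_3 with an isolated vertex: the other two
  exceptional graphs. Five non-neighbours span at most four edges and always admit a path.\<close>

definition sgraph :: "'a set \<Rightarrow> 'a set set \<Rightarrow> bool" where
  "sgraph V E \<longleftrightarrow> finite V \<and> (\<forall>e\<in>E. e \<subseteq> V \<and> card e = 2)"

definition vdeg :: "'a set set \<Rightarrow> 'a \<Rightarrow> nat" where
  "vdeg E x = card {e \<in> E. x \<in> e}"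

definition del_vertex :: "'a set set \<Rightarrow> 'a \<Rightarrow> 'a set set" where
  "del_vertex E x = {e \<in> E. x \<notin> e}"

text \<open>For lists with fewer than three entries the wrap-around produces singletons, which are
  harmless because edges have two elements.\<close>

definition sq_edges :: "'a list \<Rightarrow> 'a set set" where
  "sq_edges xs = {{xs ! i, xs ! ((i + d) mod length xs)} |i d. i < length xs \<and> d \<in> {1, 2}}"

text \<open>\<open>packable V E\<close>: the complement of \<open>(V, E)\<close> contains the square of a Hamilton cycle, listed as \<open>xs\<close>.\<close>

definition packable :: "'a set \<Rightarrow> 'a set set \<Rightarrow> bool" where
  "packable V E \<longleftrightarrow> (\<exists>xs. distinct xs \<and> set xs = V \<and> sq_edges xs \<inter> E = {})"

section \<open>Edge and degree counts\<close>

lemma sgraphD: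
  assumes "sgraph V E"
  shows "finite V" "finite E" "\<And>e. e \<in> E \<Longrightarrow> e \<subseteq> V" "\<And>e. e \<in> E \<Longrightarrow> card e = 2"
proof -
  show "finite V" "\<And>e. e \<in> E \<Longrightarrow> e \<subseteq> V" "\<And>e. e \<in> E \<Longrightarrow> card e = 2"
    using assms by (auto simp: sgraph_def)
  then have "E \<subseteq> Pow V" by auto
  then show "finite E" using \<open>finite V\<close> by (meson finite_Pow_iff finite_subset)
qed

lemma sgraph_edgeE:
  assumes "sgraph V E" "e \<in> E" "x \<in> e"
  obtains y where "e = {x, y}" "y \<noteq> x" "y \<in> V"
proof -
  have "card e = 2" "e \<subseteq> V" using assms sgraphD by blast+
  then obtain a b where "e = {a, b}" "a \<noteq> b" by (auto simp: card_2_iff)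
  then show ?thesis using that assms(3) \<open>e \<subseteq> V\<close> by blast
qed

lemma sgraph_neq:
  assumes "sgraph V E" "{x, y} \<in> E" shows "x \<noteq> y" "x \<in> V" "y \<in> V"
  using assms sgraphD(3,4)[OF assms] by auto

lemma sgraph_mono: "sgraph V E \<Longrightarrow> E' \<subseteq> E \<Longrightarrow> sgraph V E'"
  by (auto simp: sgraph_def)

lemma sgraph_del_vertex: "sgraph V E \<Longrightarrow> sgraph (V - {x}) (del_vertex E x)"
  by (auto simp: sgraph_def del_vertex_def)

lemma card_del_vertex:
  assumes "finite E" shows "card (del_vertex E x) + vdeg E x = card E"
proof -
  have "E = del_vertex E x \<union> {e \<in> E. x \<in> e}" "del_vertex E x \<inter> {e \<in> E. x \<in> e} = {}"
    by (auto simp: del_vertex_def)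
  then show ?thesis using assms unfolding vdeg_def
    by (metis card_Un_disjoint finite_Un)
qed

lemma vdeg_mono: "finite E \<Longrightarrow> E' \<subseteq> E \<Longrightarrow> vdeg E' x \<le> vdeg E x"
  unfolding vdeg_def by (rule card_mono) auto

lemma del_vertex_subset: "del_vertex E x \<subseteq> E"
  by (auto simp: del_vertex_def)

lemma vdeg_eq_0_iff: "finite E \<Longrightarrow> vdeg E x = 0 \<longleftrightarrow> (\<forall>e\<in>E. x \<notin> e)"
  unfolding vdeg_def by auto

lemma vdeg_eq_card_nbrs:
  assumes "sgraph V E" shows "vdeg E x = card {y \<in> V. {x, y} \<in> E}"
proof -
  have "{e \<in> E. x \<in> e} = (\<lambda>y. {x, y}) ` {y \<in> V. {x, y} \<in> E}"
  proof (intro equalityI subsetI)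
    fix e assume "e \<in> {e \<in> E. x \<in> e}"
    then have e: "e \<in> E" "x \<in> e" by auto
    from sgraph_edgeE[OF assms this] obtain y where "e = {x, y}" "y \<in> V" by metis
    then show "e \<in> (\<lambda>y. {x, y}) ` {y \<in> V. {x, y} \<in> E}" using e by blast
  qed auto
  moreover have "inj_on (\<lambda>y. {x, y}) {y \<in> V. {x, y} \<in> E}"
    by (auto simp: inj_on_def doubleton_eq_iff)
  ultimately show ?thesis unfolding vdeg_def by (simp add: card_image)
qed

lemma sum_vdeg:
  assumes "sgraph V E" shows "(\<Sum>x\<in>V. vdeg E x) = 2 * card E"
proof -
  have "(\<Sum>x\<in>V. vdeg E x) = (\<Sum>x\<in>V. \<Sum>e\<in>E. of_bool (x \<in> e))"
    using sgraphD[OF assms] by (simp add: vdeg_def of_bool_def sum.If_cases Int_def)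
  also have "\<dots> = (\<Sum>e\<in>E. \<Sum>x\<in>V. of_bool (x \<in> e))" by (rule sum.swap)
  also have "\<dots> = (\<Sum>e\<in>E. 2)"
  proof (rule sum.cong)
    fix e assume "e \<in> E"
    then have "{x \<in> V. x \<in> e} = e" "card e = 2" using sgraphD[OF assms] by auto
    then show "(\<Sum>x\<in>V. of_bool (x \<in> e)) = (2::nat)"
      using sgraphD(1)[OF assms] by (simp add: of_bool_def sum.If_cases Int_def)
  qed simp
  finally show ?thesis by simp
qed

lemma vdeg_eq_1E:
  assumes "sgraph V E" "vdeg E x = 1"
  obtains y where "{x, y} \<in> E" "\<And>e. e \<in> E \<Longrightarrow> x \<in> e \<Longrightarrow> e = {x, y}"
proof -
  obtain e where e: "{e \<in> E. x \<in> e} = {e}"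
    using assms(2) unfolding vdeg_def by (meson card_1_singletonE)
  then have "e \<in> E" "x \<in> e" by auto
  then obtain y where "e = {x, y}" using sgraph_edgeE[OF assms(1)] by metis
  then show ?thesis using that e by blast
qed

section \<open>Squares of cyclic orders and insertion of a vertex\<close>

lemma sq_edgesI:
  "i < length xs \<Longrightarrow> d \<in> {1, 2} \<Longrightarrow> e = {xs ! i, xs ! ((i + d) mod length xs)} \<Longrightarrow> e \<in> sq_edges xs"
  unfolding sq_edges_def by blast

lemma sq_edgesE:
  assumes "e \<in> sq_edges xs"
  obtains i d where "i < length xs" "d \<in> {1, 2}" "(i + d) mod length xs < length xs"
    "e = {xs ! i, xs ! ((i + d) mod length xs)}"
proof -
  obtain i d where *: "i < length xs" "d \<in> {1, 2}" "e = {xs ! i, xs ! ((i + d) mod length xs)}"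
    using assms unfolding sq_edges_def by blast
  have "(i + d) mod length xs < length xs" using *(1) by (intro mod_less_divisor) auto
  then show ?thesis using that * by blast
qed

lemma sq_edges_subset: "e \<in> sq_edges xs \<Longrightarrow> e \<subseteq> set xs"
proof -
  assume "e \<in> sq_edges xs"
  then obtain i d where "e = {xs ! i, xs ! ((i + d) mod length xs)}" "i < length xs"
    by (auto simp: sq_edges_def)
  moreover have "(i + d) mod length xs < length xs"
    using \<open>i < length xs\<close> by (intro mod_less_divisor) auto
  ultimately show ?thesis by auto
qed

lemma sq_edges_rotate1_subset: "sq_edges (rotate1 xs) \<subseteq> sq_edges xs"
proof
  fix e assume "e \<in> sq_edges (rotate1 xs)"
  then obtain i d where *: "e = {rotate1 xs ! i, rotate1 xs ! ((i + d) mod length xs)}"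
    "i < length xs" "d \<in> {1, 2}" by (auto simp: sq_edges_def)
  have "(i + d) mod length xs < length xs" using *(2) by (intro mod_less_divisor) auto
  then have "e = {xs ! (Suc i mod length xs), xs ! (Suc ((i + d) mod length xs) mod length xs)}"
    using * by (simp add: nth_rotate1)
  also have "Suc ((i + d) mod length xs) mod length xs = (Suc i mod length xs + d) mod length xs"
    by (metis add_Suc mod_Suc_eq mod_add_left_eq)
  finally have e: "e = {xs ! (Suc i mod length xs), xs ! ((Suc i mod length xs + d) mod length xs)}" .
  show "e \<in> sq_edges xs"
  proof (rule sq_edgesI[of "Suc i mod length xs" xs d, OF _ _ e])
    show "Suc i mod length xs < length xs" using *(2) by (intro mod_less_divisor) auto
  qed (use *(3) in auto)
qed

lemma sq_edges_rotate_subset: "sq_edges (rotate k xs) \<subseteq> sq_edges xs"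
proof (induction k)
  case (Suc k)
  then show ?case using sq_edges_rotate1_subset[of "rotate k xs"] by (simp add: rotate_Suc)
qed simp

text \<open>Insertion never brings two old vertices closer together, so the only new pairs are those
  of \<open>x\<close> with two vertices on either side.\<close>

lemma sq_edges_Cons_subset:
  assumes "length zs \<ge> 2"
  shows "sq_edges (x # zs) \<subseteq> sq_edges zs \<union>
    {{x, zs ! 0}, {x, zs ! 1}, {x, zs ! (length zs - 1)}, {x, zs ! (length zs - 2)}}"
proof
  let ?N = "length zs"
  fix e assume "e \<in> sq_edges (x # zs)"
  then obtain i d where e: "e = {(x # zs) ! i, (x # zs) ! ((i + d) mod Suc ?N)}"
    and i: "i < Suc ?N" and d: "d \<in> {1, 2}" by (auto simp: sq_edges_def)
  show "e \<in> sq_edges zs \<union>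
    {{x, zs ! 0}, {x, zs ! 1}, {x, zs ! (?N - 1)}, {x, zs ! (?N - 2)}}"
  proof (cases i)
    case 0
    with d assms e show ?thesis by auto
  next
    case (Suc j)
    consider "j + d < ?N" | "j + d = ?N" | "j + d = Suc ?N" using Suc i d by fastforce
    then show ?thesis
    proof cases
      case 1
      then have "e = {zs ! j, zs ! ((j + d) mod ?N)}" using e Suc by simp
      then show ?thesis using sq_edgesI[of j zs d e] Suc i d by simp
    next
      case 2
      then have "j = ?N - d" "(i + d) mod Suc ?N = 0" using Suc by auto
      then have "e = {x, zs ! (?N - d)}" using e Suc by (simp add: insert_commute)
      then show ?thesis using d by blast
    next
      case 3
      \<comment> \<open>This pair reaches across \<open>x\<close>: it consists of the last and the
        first entry of \<open>zs\<close>, formerly at distance one and now at distance two.\<close>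
      then have d2: "d = 2" and "j = ?N - 1" using Suc d i by auto
      then have "i + d = Suc ?N + 1" using Suc 3 by simp
      then have "(i + d) mod Suc ?N = 1" using assms by (simp only: mod_add_self1) (cases zs; simp)
      moreover have "(j + 1) mod ?N = 0" using \<open>j = ?N - 1\<close> assms by (cases zs) auto
      ultimately have "e = {zs ! j, zs ! ((j + 1) mod ?N)}" using e Suc assms by simp
      then show ?thesis using sq_edgesI[of j zs 1 e] Suc i by simp
    qed
  qed
qed

text \<open>The vertex goes into the gap before position \<open>k\<close>. The offsets 0 and 1 are
  the two positions after the gap, \<open>length zs - 1\<close> and \<open>length zs - 2\<close> the
  two before it, written so that nothing is subtracted from \<open>k\<close>. Rotating by
  \<open>k\<close> moves the gap to the front of the list.\<close>

lemma packableI_window: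
  assumes "distinct zs" "set zs = V" "sq_edges zs \<inter> E = {}" "x \<notin> V" "length zs \<ge> 2"
    and "\<And>t. t \<in> {0, 1, length zs - 1, length zs - 2} \<Longrightarrow> {x, zs ! ((k + t) mod length zs)} \<notin> E"
  shows "packable (insert x V) E"
proof -
  let ?ys = "rotate k zs"
  have y: "?ys ! t = zs ! ((k + t) mod length zs)" if "t < length zs" for t
    using that by (simp add: nth_rotate add.commute)
  have "{x, ?ys ! t} \<notin> E" if "t \<in> {0, 1, length zs - 1, length zs - 2}" for t
  proof -
    have "t < length zs" using that assms(5) by auto
    then show ?thesis using assms(6)[OF that] y[of t] by simp
  qed
  then have "{{x, ?ys ! 0}, {x, ?ys ! 1}, {x, ?ys ! (length ?ys - 1)}, {x, ?ys ! (length ?ys - 2)}} \<inter> E = {}"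
    by simp
  then have "sq_edges (x # ?ys) \<inter> E = {}"
    using sq_edges_Cons_subset[of ?ys x] sq_edges_rotate_subset[of k zs] assms(3,5) by auto
  then show ?thesis unfolding packable_def using assms(1,2,4)
    by (intro exI[of _ "x # ?ys"]) auto
qed

lemma card_shift_preimage_le:
  assumes "finite P" shows "card {k. k < N \<and> (k + t) mod N \<in> P} \<le> card (P :: nat set)"
proof (rule card_inj_on_le[OF _ _ assms])
  show "inj_on (\<lambda>k. (k + t) mod N) {k. k < N \<and> (k + t) mod N \<in> P}"
  proof (rule inj_onI, clarsimp)
    fix a b assume "a < N" "b < N" "(a + t) mod N = (b + t) mod N"
    then show "a = b"
    proof (induction a b rule: linorder_wlog)
      case (le a b)
      then have "N dvd b - a" by (metis add_le_mono1 diff_cancel2 mod_eq_dvd_iff_nat)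
      then show ?case using le by (metis diff_is_0_eq' dvd_imp_le le_antisym less_imp_diff_less
        linorder_not_less nat_le_linear zero_less_diff)
    qed auto
  qed
qed auto

text \<open>Each neighbour of \<open>x\<close> spoils only the four gaps whose window of two vertices on either side contains it.\<close>

lemma packable_insert:
  assumes "finite E" "packable V E" "x \<notin> V" "4 * vdeg E x < card V" "card V \<ge> 2"
  shows "packable (insert x V) E"
proof -
  obtain zs where zs: "distinct zs" "set zs = V" "sq_edges zs \<inter> E = {}"
    using assms(2) by (auto simp: packable_def)
  let ?N = "length zs"
  have N: "?N = card V" using zs distinct_card by fastforce
  define P where "P = {i. i < ?N \<and> {x, zs ! i} \<in> E}"
  have finP: "finite P" by (simp add: P_def)
  have "card P \<le> vdeg E x" unfolding vdeg_def
  proof (rule card_inj_on_le)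
    show "inj_on (\<lambda>i. {x, zs ! i}) P"
      using zs(1) by (auto simp: inj_on_def P_def doubleton_eq_iff nth_eq_iff_index_eq)
  qed (use assms(1) in \<open>auto simp: P_def\<close>)
  define T where "T = {0, 1, ?N - 1, ?N - 2}"
  define bad where "bad = (\<Union>t\<in>T. {k. k < ?N \<and> (k + t) mod ?N \<in> P})"
  have "card bad \<le> (\<Sum>t\<in>T. card {k. k < ?N \<and> (k + t) mod ?N \<in> P})"
    unfolding bad_def by (rule card_UN_le) (simp add: T_def)
  also have "\<dots> \<le> (\<Sum>t\<in>T. card P)" by (intro sum_mono card_shift_preimage_le finP)
  also have "\<dots> \<le> 4 * card P"
  proof -
    have "card T \<le> 4" by (simp add: T_def card_insert_if)
    then show ?thesis by simp
  qed
  also have "\<dots> < ?N" using \<open>card P \<le> vdeg E x\<close> assms(4) N by linarith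
  finally have "card bad < card {..<?N}" by simp
  moreover have "finite bad" by (auto simp: bad_def T_def)
  ultimately have "\<not> {..<?N} \<subseteq> bad" using card_mono linorder_not_less by blast
  then obtain k where k: "k < ?N" "k \<notin> bad" by auto
  show ?thesis
  proof (rule packableI_window[OF zs assms(3)])
    show "2 \<le> ?N" using assms(5) N by simp
    fix t assume "t \<in> {0, 1, ?N - 1, ?N - 2}"
    then have "(k + t) mod ?N \<notin> P" using k by (auto simp: bad_def T_def)
    moreover have "(k + t) mod ?N < ?N" using k by (intro mod_less_divisor) auto
    ultimately show "{x, zs ! ((k + t) mod ?N)} \<notin> E" by (auto simp: P_def)
  qed
qed

lemma packable_del_vertex:
  assumes "packable (V - {x}) (del_vertex E x)" shows "packable (V - {x}) E"
proof -
  obtain xs where "distinct xs" "set xs = V - {x}" "sq_edges xs \<inter> del_vertex E x = {}"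
    using assms by (auto simp: packable_def)
  moreover have "sq_edges xs \<inter> E \<subseteq> del_vertex E x"
    using sq_edges_subset[of _ xs] \<open>set xs = V - {x}\<close> by (fastforce simp: del_vertex_def)
  ultimately show ?thesis unfolding packable_def by blast
qed

lemma packable_delete_step:
  assumes "sgraph V E" "x \<in> V" "4 * vdeg E x < card V - 1" "card V \<ge> 3"
    and "packable (V - {x}) (del_vertex E x)"
  shows "packable V E"
proof -
  have "packable (insert x (V - {x})) E"
    using assms(2-4) sgraphD(1,2)[OF assms(1)] packable_del_vertex[OF assms(5)]
    by (intro packable_insert) auto
  then show ?thesis using assms(2) by (simp add: insert_absorb)
qed

text \<open>For degree at most one, insertion asks for more than four vertices, hence the five. Once
  a core of this size is arranged, leaves and isolated vertices can be added one after the
  other.\<close>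

lemma packable_extend:
  assumes "sgraph V E" "packable B E" "B \<subseteq> V" "card B \<ge> 5" "\<And>x. x \<in> V - B \<Longrightarrow> vdeg E x \<le> 1"
  shows "packable V E"
proof -
  have "packable (B \<union> X) E" if "finite X" "X \<subseteq> V - B" for X
    using that
  proof (induction X)
    case (insert x X)
    have "finite B" using assms(3) sgraphD(1)[OF assms(1)] finite_subset by blast
    then have "card B \<le> card (B \<union> X)" using insert by (intro card_mono) auto
    moreover have "vdeg E x \<le> 1" using insert.prems assms(5) by auto
    ultimately have "packable (insert x (B \<union> X)) E"
      using insert assms(4) sgraphD(2)[OF assms(1)] by (intro packable_insert) auto
    then show ?case by simp
  qed (use assms(2) in simp)
  from this[of "V - B"] have "packable (B \<union> (V - B)) E" using sgraphD(1)[OF assms(1)] by simp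
  moreover have "B \<union> (V - B) = V" using assms(3) by blast
  ultimately show ?thesis by simp
qed

section \<open>Pendant edges, merging and isolated vertices\<close>

lemma sq_edges_map:
  assumes "e \<in> sq_edges (map f xs)"
  obtains e' where "e' \<in> sq_edges xs" "e = f ` e'"
proof -
  obtain i d where *: "i < length xs" "d \<in> {1, 2}" "(i + d) mod length xs < length xs"
    "e = {map f xs ! i, map f xs ! ((i + d) mod length xs)}"
    using sq_edgesE[OF assms] by (metis length_map)
  then have "e = f ` {xs ! i, xs ! ((i + d) mod length xs)}" using * by simp
  then show ?thesis using that sq_edgesI[OF *(1,2) refl] by blast
qed

text \<open>Two neighbours lie ahead of \<open>y\<close> and at most two behind. The latter are
  counted as preimages under a shift, which avoids subtraction modulo the length.\<close>

lemma card_sq_nbrs_le: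
  assumes "distinct xs" shows "card {w. {w, y} \<in> sq_edges xs} \<le> 4"
proof (cases "y \<in> set xs")
  case False
  then have "{w. {w, y} \<in> sq_edges xs} = {}" using sq_edges_subset by fastforce
  then show ?thesis by simp
next
  case True
  let ?N = "length xs"
  obtain i where i: "i < ?N" "y = xs ! i" using True by (metis in_set_conv_nth)
  have "{w. {w, y} \<in> sq_edges xs} \<subseteq> (\<lambda>j. xs ! j) `
    ((\<lambda>d. (i + d) mod ?N) ` {1, 2} \<union> (\<Union>d\<in>{1, 2}. {j. j < ?N \<and> (j + d) mod ?N \<in> {i}}))"
  proof
    fix w assume "w \<in> {w. {w, y} \<in> sq_edges xs}"
    then have "{w, y} \<in> sq_edges xs" by simp
    from sq_edgesE[OF this] obtain j d where *: "{w, y} = {xs ! j, xs ! ((j + d) mod ?N)}"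
      "j < ?N" "d \<in> {1, 2}" and jd: "(j + d) mod ?N < ?N" by metis
    show "w \<in> (\<lambda>j. xs ! j) ` ((\<lambda>d. (i + d) mod ?N) ` {1, 2} \<union>
      (\<Union>d\<in>{1, 2}. {j. j < ?N \<and> (j + d) mod ?N \<in> {i}}))"
    proof (cases "y = xs ! j")
      case True
      then have "i = j" using i * assms by (simp add: nth_eq_iff_index_eq)
      then have "w = xs ! ((i + d) mod ?N)" using * True by (auto simp: doubleton_eq_iff)
      then show ?thesis using *(3) by blast
    next
      case False
      then have w: "w = xs ! j" "xs ! i = xs ! ((j + d) mod ?N)"
        using * i by (auto simp: doubleton_eq_iff)
      then have "(j + d) mod ?N = i" using i jd assms by (simp add: nth_eq_iff_index_eq)
      then show ?thesis using w *(2,3) by blast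
    qed
  qed
  then have "card {w. {w, y} \<in> sq_edges xs} \<le> card ((\<lambda>j. xs ! j) `
    ((\<lambda>d. (i + d) mod ?N) ` {1, 2} \<union> (\<Union>d\<in>{1, 2}. {j. j < ?N \<and> (j + d) mod ?N \<in> {i}})))"
    by (intro card_mono) auto
  also have "\<dots> \<le> card ((\<lambda>d. (i + d) mod ?N) ` {1, 2} \<union>
      (\<Union>d\<in>{1, 2}. {j. j < ?N \<and> (j + d) mod ?N \<in> {i}}))"
    by (intro card_image_le) auto
  also have "\<dots> \<le> card ((\<lambda>d. (i + d) mod ?N) ` {1, 2::nat}) +
      card (\<Union>d\<in>{1, 2::nat}. {j. j < ?N \<and> (j + d) mod ?N \<in> {i}})"
    by (rule card_Un_le)
  also have "\<dots> \<le> card {1, 2::nat} + (\<Sum>d\<in>{1, 2::nat}. card {j. j < ?N \<and> (j + d) mod ?N \<in> {i}})"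
    by (intro add_mono card_image_le card_UN_le) auto
  also have "\<dots> \<le> 2 + (\<Sum>d\<in>{1, 2::nat}. card {i})"
    by (intro add_mono sum_mono card_shift_preimage_le) auto
  finally show ?thesis by simp
qed

text \<open>If \<open>x\<close> is too close to \<open>y\<close>, swap it with an isolated vertex away from \<open>y\<close>.\<close>

lemma packable_add_pendant:
  assumes "sgraph V E" "vdeg E x = 1" "{x, y} \<in> E" "card {w \<in> V. vdeg E w = 0} \<ge> 4"
    and "packable V (E - {{x, y}})"
  shows "packable V E"
proof -
  note fin = sgraphD[OF assms(1)]
  obtain xs where xs: "distinct xs" "set xs = V" "sq_edges xs \<inter> (E - {{x, y}}) = {}"
    using assms(5) by (auto simp: packable_def)
  obtain y' where y': "\<And>e. e \<in> E \<Longrightarrow> x \<in> e \<Longrightarrow> e = {x, y'}"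
    using vdeg_eq_1E[OF assms(1,2)] by blast
  have xe: "e = {x, y}" if "e \<in> E" "x \<in> e" for e
    using y'[OF that] y'[OF assms(3)] by simp
  show ?thesis
  proof (cases "{x, y} \<in> sq_edges xs")
    case False
    then show ?thesis using xs unfolding packable_def by blast
  next
    case True
    let ?W = "{w \<in> V. vdeg E w = 0}" and ?S = "{w. {w, y} \<in> sq_edges xs}"
    have "x \<in> ?S" "x \<notin> ?W" using True assms(2) by auto
    have finS: "finite ?S"
    proof (rule finite_subset)
      show "?S \<subseteq> V" using sq_edges_subset xs(2) by fastforce
    qed (rule fin)
    \<comment> \<open>One of the at most four places next to \<open>y\<close> is taken by
      \<open>x\<close>, which is not isolated; hence at most three isolated vertices are near
      \<open>y\<close>, and a fourth one is not.\<close>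
    have "card (?S \<inter> ?W) < card ?S"
      by (rule psubset_card_mono[OF finS]) (use \<open>x \<in> ?S\<close> \<open>x \<notin> ?W\<close> in blast)
    also have "\<dots> \<le> card ?W" using card_sq_nbrs_le[OF xs(1)] assms(4) le_trans by blast
    finally have "?S \<inter> ?W \<noteq> ?W" by auto
    then obtain w where w: "w \<in> V" "vdeg E w = 0" "{w, y} \<notin> sq_edges xs" by blast
    have we: "w \<notin> e" if "e \<in> E" for e using w(2) that vdeg_eq_0_iff[OF fin(2)] by blast
    have neq: "x \<noteq> y" "x \<noteq> w" "y \<noteq> w" "x \<in> V" "y \<in> V"
      using sgraph_neq[OF assms(1,3)] we[OF assms(3)] by auto
    \<comment> \<open>This transposition leaves all edges except \<open>{x, y}\<close> in place,
      since \<open>x\<close> is a leaf and \<open>w\<close> is isolated; \<open>{x, y}\<close> moves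
      to the pair formerly occupied by \<open>{w, y}\<close>.\<close>
    define f where "f = (\<lambda>u. if u = x then w else if u = w then x else u)"
    have ff: "f (f u) = u" for u by (auto simp: f_def)
    have "f ` V = V" using neq w by (auto simp: f_def image_iff)
    have "sq_edges (map f xs) \<inter> E = {}"
    proof (rule ccontr)
      assume "sq_edges (map f xs) \<inter> E \<noteq> {}"
      then obtain e where "e \<in> E" "e \<in> sq_edges (map f xs)" by blast
      then obtain e' where e': "e' \<in> sq_edges xs" "e = f ` e'" using sq_edges_map by metis
      then have "e' = f ` e" by (simp add: image_image ff)
      show False
      proof (cases "x \<in> e")
        case True
        then have "e' = {w, y}" using xe[OF \<open>e \<in> E\<close>] \<open>e' = f ` e\<close> neq by (auto simp: f_def)
        then show False using e' w by blast
      next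
        case False
        then have "f ` e = e" using we[OF \<open>e \<in> E\<close>] by (auto simp: f_def image_iff)
        then have "e \<in> sq_edges xs" using e'(1) \<open>e' = f ` e\<close> by simp
        moreover have "e \<in> E - {{x, y}}" using False \<open>e \<in> E\<close> by auto
        ultimately show False using xs(3) by (metis disjoint_iff)
      qed
    qed
    moreover have "inj f" by (rule inj_on_inverseI[of _ f]) (rule ff)
    then have "distinct (map f xs)" using xs(1) inj_on_subset[OF \<open>inj f\<close>, of "set xs"] by (simp add: distinct_map)
    moreover have "set (map f xs) = V" using xs(2) \<open>f ` V = V\<close> by simp
    ultimately show ?thesis unfolding packable_def by blast
  qed
qed

definition rename_vertex :: "'a \<Rightarrow> 'a \<Rightarrow> 'a set \<Rightarrow> 'a set" where
  "rename_vertex v u e = (if v \<in> e then insert u (e - {v}) else e)"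

text \<open>Identify \<open>v\<close> with \<open>u\<close>, arrange, and put \<open>v\<close> back right after \<open>u\<close>.\<close>

lemma packable_merge:
  assumes "sgraph V E" "u \<in> V" "v \<in> V" "u \<noteq> v" "{u, v} \<notin> E" "card V \<ge> 6"
    and "packable (V - {v}) (rename_vertex v u ` E)"
  shows "packable V E"
proof -
  obtain xs where xs: "distinct xs" "set xs = V - {v}" "sq_edges xs \<inter> rename_vertex v u ` E = {}"
    using assms(7) by (auto simp: packable_def)
  let ?N = "length xs"
  have N: "?N = card V - 1" using xs(1,2) assms(3) distinct_card by fastforce
  obtain i where i: "i < ?N" "xs ! i = u"
    using xs(2) assms(2,4) by (metis Diff_iff empty_iff in_set_conv_nth insert_iff)
  have A: "{v, z} \<notin> E" if "{u, z} \<in> sq_edges xs" for z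
  proof
    assume *: "{v, z} \<in> E"
    then have "rename_vertex v u {v, z} = {u, z}"
      using sgraph_neq[OF assms(1) *] by (auto simp: rename_vertex_def)
    then show False using that xs(3) * by (metis disjoint_iff imageI)
  qed
  have E': "e \<in> rename_vertex v u ` E" if "e \<in> E" "v \<notin> e" for e
    using that by (force simp: rename_vertex_def image_iff)
  have "sq_edges xs \<inter> E = {}"
    using xs(2,3) E' sq_edges_subset[of _ xs] by fastforce
  \<comment> \<open>The gap is the one just after \<open>u\<close>, which has position
    \<open>i\<close>. Offsets 0 and 1 are the two successors of \<open>u\<close>,
    \<open>?N - 1\<close> is \<open>u\<close> itself, and \<open>?N - 2\<close> is its predecessor;
    \<open>A\<close> covers all of them except \<open>u\<close>.\<close>
  moreover have "{v, xs ! ((Suc i + t) mod ?N)} \<notin> E" if t: "t \<in> {0, 1, ?N - 1, ?N - 2}" for t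
  proof -
    consider "t = 0" | "t = 1" | "t = ?N - 1" | "t = ?N - 2" using t by blast
    then show ?thesis
    proof cases
      case 1
      then show ?thesis by (intro A sq_edgesI[of i xs 1]) (use i in auto)
    next
      case 2
      then show ?thesis by (intro A sq_edgesI[of i xs 2]) (use i in auto)
    next
      case 3
      then have "Suc i + t = i + ?N" using i by auto
      then have "(Suc i + t) mod ?N = i" using i by (metis mod_add_self2 mod_less)
      then show ?thesis using i assms(5) by (simp add: insert_commute)
    next
      case 4
      then have *: "Suc i + t + 1 = i + ?N" using i assms(6) N by auto
      have "((Suc i + t) mod ?N + 1) mod ?N = (Suc i + t + 1) mod ?N" by (rule mod_add_left_eq)
      also have "\<dots> = i" using * i by (metis mod_add_self2 mod_less)
      finally have "((Suc i + t) mod ?N + 1) mod ?N = i" .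
      then show ?thesis using i
        by (intro A sq_edgesI[of "(Suc i + t) mod ?N" xs 1]) (auto simp: insert_commute intro: mod_less_divisor)
    qed
  qed
  ultimately have "packable (insert v (V - {v})) E"
    using N assms(6) by (intro packableI_window[OF xs(1,2), where k = "Suc i"]) (auto simp del: One_nat_def)
  then show ?thesis using assms(3) by (simp add: insert_absorb)
qed

text \<open>Isolated vertices \<open>zs\<close> separate the elements of \<open>vs\<close>, which get distance at least three.\<close>

fun spaced :: "'a list \<Rightarrow> 'a list \<Rightarrow> 'a list" where
  "spaced (v # vs) (z # z' # zs) = v # z # z' # spaced vs zs"
| "spaced vs zs = vs @ zs"

lemma set_spaced: "set (spaced vs zs) = set vs \<union> set zs"
  by (induction vs zs rule: spaced.induct) auto

lemma length_spaced: "length (spaced vs zs) = length vs + length zs"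
  by (induction vs zs rule: spaced.induct) auto

lemma distinct_spaced:
  "distinct vs \<Longrightarrow> distinct zs \<Longrightarrow> set vs \<inter> set zs = {} \<Longrightarrow> distinct (spaced vs zs)"
  by (induction vs zs rule: spaced.induct) (auto simp: set_spaced)

text \<open>The second conjunct says that two further positions follow each element of
  \<open>vs\<close> before the list ends. This rules out close pairs across the wrap-around.\<close>

lemma nth_spaced_in_vs:
  assumes "2 * length vs \<le> length zs" "set vs \<inter> set zs = {}"
    and "i < length vs + length zs" "spaced vs zs ! i \<in> set vs"
  shows "i mod 3 = 0 \<and> i + 3 \<le> 3 * length vs"
  using assms
proof (induction vs zs arbitrary: i rule: spaced.induct)
  case (1 v vs z z' zs)
  consider "i = 0" | "i = 1" | "i = 2" | j where "i = Suc (Suc (Suc j))"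
    by (cases i; cases "i - 1"; cases "i - 2") auto
  then show ?case
  proof cases
    case 4
    have "spaced vs zs ! j \<in> set (spaced vs zs)"
      using 1(4) 4 by (intro nth_mem) (auto simp: length_spaced)
    then have "spaced vs zs ! j \<in> set vs" using 1(3,5) 4 by (auto simp: set_spaced)
    then have "j mod 3 = 0 \<and> j + 3 \<le> 3 * length vs"
      using 1(2,3,4) 4 by (intro 1(1)) auto
    then show ?thesis using 4 by (simp add: mod_Suc)
  qed (use 1 in auto)
next
  case ("2_2" vs)
  then show ?case by (cases vs) auto
next
  case ("2_3" vs z)
  then show ?case by (cases vs) auto
qed auto

text \<open>\<open>K\<close> may be any vertex set containing all edges; its elements are placed at
  pairwise distance at least three, whatever the edges are. For a clique on at least two vertices
  \<open>3 * card K \<le> card V\<close> is also necessary.\<close>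

lemma packable_spaced:
  assumes "sgraph V E" "K \<subseteq> V" "3 * card K \<le> card V" "\<And>e. e \<in> E \<Longrightarrow> e \<subseteq> K"
  shows "packable V E"
proof -
  have fin: "finite V" using sgraphD(1)[OF assms(1)] .
  then have "finite K" using assms(2) finite_subset by blast
  note fin = fin this
  obtain vs where vs: "set vs = K" "distinct vs" using finite_distinct_list[OF fin(2)] by blast
  obtain zs where zs: "set zs = V - K" "distinct zs"
    using finite_distinct_list[of "V - K"] fin by blast
  have len: "length vs = card K" "length zs = card V - card K"
    using distinct_card[OF vs(2)] distinct_card[OF zs(2)] vs zs fin assms(2)
    by (auto simp: card_Diff_subset)
  have le: "2 * length vs \<le> length zs" using len assms(3) by linarith
  let ?xs = "spaced vs zs"
  let ?n = "length ?xs"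
  have n: "?n = length vs + length zs" by (simp add: length_spaced)
  have "sq_edges ?xs \<inter> E = {}"
  proof (rule ccontr)
    assume "sq_edges ?xs \<inter> E \<noteq> {}"
    then obtain e where "e \<in> sq_edges ?xs" "e \<in> E" by blast
    then obtain i d where *: "{?xs ! i, ?xs ! ((i + d) mod ?n)} \<in> E" "i < ?n" "d \<in> {1, 2}"
      and lt: "(i + d) mod ?n < ?n" using sq_edgesE by metis
    have K: "?xs ! i \<in> set vs" "?xs ! ((i + d) mod ?n) \<in> set vs"
      using assms(4)[OF *(1)] vs by auto
    have dis: "set vs \<inter> set zs = {}" using vs zs by auto
    have 1: "i mod 3 = 0" "i + 3 \<le> 3 * length vs"
      using nth_spaced_in_vs[OF le dis _ K(1)] *(2) n by auto
    have 2: "((i + d) mod ?n) mod 3 = 0"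
      using nth_spaced_in_vs[OF le dis _ K(2)] lt n by auto
    have "i + d < ?n" using 1(2) le *(3) n by auto
    then have "(i + d) mod 3 = 0" using 2 by simp
    then show False using 1(1) *(3) by auto presburger+
  qed
  moreover have "set ?xs = V" using vs zs assms(2) by (auto simp: set_spaced)
  moreover have "distinct ?xs" using vs zs by (intro distinct_spaced) auto
  ultimately show ?thesis unfolding packable_def by blast
qed

section \<open>Graphs with four isolated vertices\<close>

lemma rename_vertex_sgraph:
  assumes "sgraph V E" "u \<in> V" "v \<in> V" "u \<noteq> v" "{u, v} \<notin> E"
  shows "sgraph (V - {v}) (rename_vertex v u ` E)"
proof -
  have "rename_vertex v u e \<subseteq> V - {v} \<and> card (rename_vertex v u e) = 2" if e: "e \<in> E" for e
  proof (cases "v \<in> e")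
    case True
    obtain y where y: "e = {v, y}" "y \<noteq> v" "y \<in> V" using sgraph_edgeE[OF assms(1) e True] by metis
    then have "y \<noteq> u" using assms(5) e by (auto simp: insert_commute)
    moreover have "rename_vertex v u e = {u, y}" using y by (auto simp: rename_vertex_def)
    ultimately show ?thesis using assms(2,4) y by auto
  next
    case False
    then show ?thesis using sgraphD[OF assms(1)] e by (auto simp: rename_vertex_def)
  qed
  then show ?thesis using sgraphD(1)[OF assms(1)] unfolding sgraph_def by blast
qed

lemma exists_nonadjacent:
  assumes "sgraph V E" "finite K" "2 * card E < card K * (card K - 1)"
  obtains u v where "u \<in> K" "v \<in> K" "u \<noteq> v" "{u, v} \<notin> E"
proof -
  have "\<exists>u v. u \<in> K \<and> v \<in> K \<and> u \<noteq> v \<and> {u, v} \<notin> E"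
  proof (rule ccontr)
    assume "\<not> ?thesis"
    then have "{e. e \<subseteq> K \<and> card e = 2} \<subseteq> E" by (auto simp: card_2_iff)
    then have "card {e. e \<subseteq> K \<and> card e = 2} \<le> card E"
      using sgraphD(2)[OF assms(1)] by (rule card_mono[rotated])
    then have "card K choose 2 \<le> card E" using assms(2) by (simp add: n_subsets)
    moreover have "2 * (card K choose 2) = card K * (card K - 1)"
    proof -
      have "even (card K * (card K - 1))" by (cases "even (card K)") auto
      then show ?thesis unfolding choose_two by (rule dvd_mult_div_cancel)
    qed
    ultimately show False using assms(3) by linarith
  qed
  then show ?thesis using that by blast
qed

text \<open>A merge lowers both \<open>card K\<close> and \<open>card V\<close> by one, so the
  excess of \<open>3 * card K\<close> over \<open>card V\<close> drops by two. The smaller instance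
  is left open as a hypothesis, which allows the step to be nested.\<close>

lemma packable_merge_step:
  fixes V :: "'a set"
  assumes "sgraph V E" "K \<subseteq> V" "\<And>e. e \<in> E \<Longrightarrow> e \<subseteq> K" "card V \<ge> 6"
    and "2 * card E < card K * (card K - 1)"
    and "\<And>(V' :: 'a set) E' K'. \<lbrakk>sgraph V' E'; K' \<subseteq> V'; \<And>e. e \<in> E' \<Longrightarrow> e \<subseteq> K'; card V' = card V - 1;
      card K' = card K - 1; card E' \<le> card E\<rbrakk> \<Longrightarrow> packable V' E'"
  shows "packable V E"
proof -
  have fin: "finite V" "finite E" "finite K"
    using sgraphD(1,2)[OF assms(1)] assms(2) finite_subset by blast+
  obtain u v where uv: "u \<in> K" "v \<in> K" "u \<noteq> v" "{u, v} \<notin> E"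
    using exists_nonadjacent[OF assms(1) fin(3) assms(5)] by blast
  have "packable (V - {v}) (rename_vertex v u ` E)"
  proof (rule assms(6)[where K' = "K - {v}"])
    show "sgraph (V - {v}) (rename_vertex v u ` E)"
      using rename_vertex_sgraph[OF assms(1)] uv assms(2) by blast
    show "card (V - {v}) = card V - 1" "card (K - {v}) = card K - 1"
      using uv assms(2) fin by auto
    show "card (rename_vertex v u ` E) \<le> card E" using fin by (intro card_image_le)
    show "e \<subseteq> K - {v}" if "e \<in> rename_vertex v u ` E" for e
      using that assms(3) uv by (fastforce simp: rename_vertex_def split: if_splits)
  qed (use assms(2) in auto)
  then show ?thesis using packable_merge[OF assms(1) _ _ uv(3,4)] uv assms(2,4) by blast
qed

text \<open>\<open>(n + 2) div 4\<close> is \<open>(n - 1) / 4\<close> rounded up, the least degree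
  for which the deletion step fails, and \<open>k\<close> counts the vertices that are not isolated.
  The alternatives correspond to no merge, one merge and two merges; the inequalities for
  \<open>2 * m\<close> provide a nonadjacent pair before each merge.\<close>

lemma dense_stuck_numeric:
  fixes n m k :: nat
  assumes "10 \<le> n" "m + 2 \<le> n" "m + 20 \<le> 2 * n" "k * ((n + 2) div 4) \<le> 2 * m"
  shows "3 * k \<le> n \<or> 3 * k \<le> n + 2 \<and> 2 * m < k * (k - 1) \<or>
    3 * k \<le> n + 4 \<and> 2 * m < k * (k - 1) \<and> 2 * m < (k - 1) * (k - 1 - 1)"
proof -
  have "k * (n - 1) \<le> k * (4 * ((n + 2) div 4))" by (intro mult_le_mono2) linarith
  then have k: "k * (n - 1) \<le> 8 * m" using assms(4) by linarith
  have "k \<le> 7"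
  proof (rule ccontr)
    assume "\<not> k \<le> 7"
    then have "8 * (n - 1) \<le> k * (n - 1)" by (intro mult_le_mono1) simp
    then show False using k assms(1,2) by linarith
  qed
  \<comment> \<open>From 21 vertices on, seven vertices can be spaced without merging; the smaller
    values of \<open>n\<close> are checked one by one.\<close>
  show ?thesis
  proof (cases "n \<ge> 21")
    case False
    then have "n \<in> {10,11,12,13,14,15,16,17,18,19,20}" using assms(1) by simp presburger
    moreover have "k \<in> {0,1,2,3,4,5,6,7}" using \<open>k \<le> 7\<close> by auto
    ultimately show ?thesis using assms by (elim insertE emptyE; hypsubst; simp)
  qed (use \<open>k \<le> 7\<close> in linarith)
qed

text \<open>The first edge bound is the sharper one above 18 vertices, the second below. A deleted
  vertex takes at least two edges with it, which preserves both. The measure includes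
  \<open>card E\<close> because dropping the edge at a leaf keeps \<open>V\<close>.\<close>

lemma packable_dense:
  assumes "sgraph V E" "card V \<ge> 10" "card E + 2 \<le> card V" "card E + 20 \<le> 2 * card V"
    and "card {w \<in> V. vdeg E w = 0} \<ge> 4"
  shows "packable V E"
  using assms
proof (induction "card V + card E" arbitrary: V E rule: less_induct)
  case less
  note fin = sgraphD(1,2)[OF less.prems(1)]
  let ?W = "{w \<in> V. vdeg E w = 0}"
  show ?case
  proof (cases "\<exists>x\<in>V. vdeg E x = 1")
    case True
    then obtain x where x: "x \<in> V" "vdeg E x = 1" by blast
    obtain y where y: "{x, y} \<in> E" using vdeg_eq_1E[OF less.prems(1) x(2)] by metis
    let ?E = "E - {{x, y}}"
    have c: "card ?E + 1 = card E" using card_Suc_Diff1[OF fin(2) y] by simp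
    have "?W \<subseteq> {w \<in> V. vdeg ?E w = 0}"
      using vdeg_mono[OF fin(2), of ?E] by (auto simp: le_0_eq) (metis le_0_eq)
    then have "card ?W \<le> card {w \<in> V. vdeg ?E w = 0}" using fin by (intro card_mono) auto
    then have "packable V ?E" using less.prems c
      by (intro less.hyps) (auto intro: sgraph_mono)
    then show ?thesis by (intro packable_add_pendant[OF less.prems(1) x(2) y less.prems(5)])
  next
    case no1: False
    show ?thesis
    proof (cases "\<exists>x\<in>V. 2 \<le> vdeg E x \<and> 4 * vdeg E x < card V - 1")
      case True
      then obtain x where x: "x \<in> V" "2 \<le> vdeg E x" "4 * vdeg E x < card V - 1" by blast
      let ?E = "del_vertex E x"
      have c: "card ?E + vdeg E x = card E" "card (V - {x}) + 1 = card V"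
        using card_del_vertex[OF fin(2)] x fin by (auto simp: card_gt_0_iff)
      have "?W \<subseteq> {w \<in> V - {x}. vdeg ?E w = 0}"
        using vdeg_mono[OF fin(2) del_vertex_subset] x by (auto simp: le_0_eq) (metis le_0_eq)
      then have "card ?W \<le> card {w \<in> V - {x}. vdeg ?E w = 0}" using fin by (intro card_mono) auto
      then have "packable (V - {x}) ?E" using less.prems c x
        by (intro less.hyps) (auto intro: sgraph_del_vertex)
      then show ?thesis using x less.prems by (intro packable_delete_step[OF less.prems(1) x(1,3)]) auto
    next
      case False
      define K where "K = {x \<in> V. vdeg E x \<noteq> 0}"
      have K: "K \<subseteq> V" "\<And>e. e \<in> E \<Longrightarrow> e \<subseteq> K"
        using sgraphD[OF less.prems(1)] vdeg_eq_0_iff[OF fin(2)] by (auto simp: K_def)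
      have deg: "(card V + 2) div 4 \<le> vdeg E x" if "x \<in> K" for x
      proof -
        have "vdeg E x \<ge> 2" using that no1 unfolding K_def
          by (metis (mono_tags, lifting) One_nat_def less_2_cases linorder_not_le mem_Collect_eq)
        then have "card V - 1 \<le> 4 * vdeg E x" using that False unfolding K_def by force
        then show ?thesis by linarith
      qed
      have "card K * ((card V + 2) div 4) \<le> (\<Sum>x\<in>K. vdeg E x)"
        using sum_bounded_below[of K "(card V + 2) div 4" "vdeg E"] deg by simp
      also have "\<dots> \<le> (\<Sum>x\<in>V. vdeg E x)" using fin K(1) by (intro sum_mono2) auto
      also have "\<dots> = 2 * card E" by (rule sum_vdeg[OF less.prems(1)])
      finally consider "3 * card K \<le> card V"
        | "3 * card K \<le> card V + 2" "2 * card E < card K * (card K - 1)"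
        | "3 * card K \<le> card V + 4" "2 * card E < card K * (card K - 1)"
          "2 * card E < (card K - 1) * (card K - 1 - 1)"
        using dense_stuck_numeric[of "card V" "card E" "card K"] less.prems by blast
      then show ?thesis
      proof cases
        case 1
        then show ?thesis using packable_spaced[OF less.prems(1) K(1) _ K(2)] by blast
      next
        case 2
        then show ?thesis using less.prems(2)
          by (intro packable_merge_step[OF less.prems(1) K] packable_spaced) auto
      next
        case 3
        show ?thesis
        proof (rule packable_merge_step[OF less.prems(1) K _ 3(2)])
          fix V' :: "'a set" and E' K'
          assume *: "sgraph V' E'" "K' \<subseteq> V'" "\<And>e. e \<in> E' \<Longrightarrow> e \<subseteq> K'" "card V' = card V - 1"
            "card K' = card K - 1" "card E' \<le> card E"
          show "packable V' E'"
          proof (rule packable_merge_step[OF *(1-3)])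
            show "2 * card E' < card K' * (card K' - 1)" using 3(3) * by simp
            fix V'' :: "'a set" and E'' K''
            assume "sgraph V'' E''" "K'' \<subseteq> V''" "\<And>e. e \<in> E'' \<Longrightarrow> e \<subseteq> K''" "card V'' = card V' - 1"
              "card K'' = card K' - 1" "card E'' \<le> card E'"
            then show "packable V'' E''" using * 3(1) less.prems(2) by (intro packable_spaced[of V'' E'' K'']) auto
          qed (use * less.prems in auto)
        qed (use less.prems in auto)
      qed
    qed
  qed
qed

section \<open>Explicit arrangements and paths in the complement\<close>

text \<open>The last pair of the list is not tested. On \<open>xs @ take 2 xs\<close> the recursion
  therefore tests exactly the two pairs that start at each position of \<open>xs\<close>,
  wrap-around included.\<close>

fun square_path_avoids :: "'a set set \<Rightarrow> 'a list \<Rightarrow> bool" where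
  "square_path_avoids E (a # b # c # xs) \<longleftrightarrow>
     {a, b} \<notin> E \<and> {a, c} \<notin> E \<and> square_path_avoids E (b # c # xs)"
| "square_path_avoids E _ \<longleftrightarrow> True"

lemma square_path_avoids_nth:
  assumes "square_path_avoids E ys" "i + 2 < length ys" "d \<in> {1, 2}"
  shows "{ys ! i, ys ! (i + d)} \<notin> E"
  using assms
proof (induction E ys arbitrary: i rule: square_path_avoids.induct)
  case (1 E a b c xs)
  then show ?case by (cases i) auto
qed auto

lemma packable_list:
  assumes "distinct xs" "length xs \<ge> 2" "square_path_avoids E (xs @ take 2 xs)"
  shows "packable (set xs) E"
proof -
  have "e \<notin> E" if e: "e \<in> sq_edges xs" for e
  proof -
    obtain i d where *: "i < length xs" "d \<in> {1, 2}" "e = {xs ! i, xs ! ((i + d) mod length xs)}"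
      using sq_edgesE[OF e] by metis
    have len: "length (xs @ take 2 xs) = length xs + 2" using assms(2) by simp
    have "(xs @ take 2 xs) ! (i + d) = xs ! ((i + d) mod length xs)"
    proof (cases "i + d < length xs")
      case False
      then have "(i + d) mod length xs = i + d - length xs"
        using * assms(2) by (subst le_mod_geq) auto
      moreover have "i + d - length xs < 2" using * False by auto
      ultimately show ?thesis using False by (simp add: nth_append)
    qed (simp add: nth_append)
    moreover have "(xs @ take 2 xs) ! i = xs ! i" using * by (simp add: nth_append)
    ultimately show ?thesis
      using square_path_avoids_nth[OF assms(3), of i d] * len by simp
  qed
  then show ?thesis using assms(1) unfolding packable_def by blast
qed

lemma packable_independent:
  assumes "finite F" "\<And>e. e \<in> E \<Longrightarrow> \<not> e \<subseteq> F" shows "packable F E"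
proof -
  obtain xs where "set xs = F" "distinct xs" using finite_distinct_list[OF assms(1)] by blast
  moreover from this have "sq_edges xs \<inter> E = {}" using sq_edges_subset[of _ xs] assms(2) by blast
  ultimately show ?thesis unfolding packable_def by blast
qed

text \<open>From each edge inside \<open>F0\<close> one chosen end is discarded.\<close>

lemma exists_independent:
  assumes "sgraph V E" "finite F0"
  obtains F where "F \<subseteq> F0" "\<And>e. e \<in> E \<Longrightarrow> \<not> e \<subseteq> F" "card F0 \<le> card F + card {e \<in> E. e \<subseteq> F0}"
proof
  define g where "g = (\<lambda>e. SOME x :: 'a. x \<in> e)"
  let ?S = "{e \<in> E. e \<subseteq> F0}"
  have "finite ?S" using sgraphD(2)[OF assms(1)] by simp
  then have "card (g ` ?S) \<le> card ?S" by (rule card_image_le)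
  moreover have "card F0 - card (g ` ?S) \<le> card (F0 - g ` ?S)"
    using \<open>finite ?S\<close> by (intro diff_card_le_card_Diff) auto
  ultimately show "card F0 \<le> card (F0 - g ` ?S) + card ?S" by linarith
  show "\<not> e \<subseteq> F0 - g ` ?S" if "e \<in> E" for e
  proof
    assume *: "e \<subseteq> F0 - g ` ?S"
    have "e \<noteq> {}" using sgraphD(4)[OF assms(1) that] by auto
    then have "g e \<in> e" unfolding g_def by (simp add: some_in_eq)
    then show False using * that by blast
  qed
qed auto

section \<open>Paths on four vertices in the complement\<close>

definition nonadjacent_path :: "'a set set \<Rightarrow> 'a \<Rightarrow> 'a \<Rightarrow> 'a \<Rightarrow> 'a \<Rightarrow> bool" where
  "nonadjacent_path E a b c d \<longleftrightarrow>
     distinct [a, b, c, d] \<and> {a, b} \<notin> E \<and> {b, c} \<notin> E \<and> {c, d} \<notin> E"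

text \<open>The average degree inside \<open>U\<close> is below two, so some \<open>u\<close> has at
  most one neighbour there. If it has none, \<open>p\<close> is an arbitrary other vertex.\<close>

lemma exists_sparse_vertex:
  assumes "sgraph V E" "U \<subseteq> V" "card {e \<in> E. e \<subseteq> U} < card U" "card U \<ge> 2"
  obtains u p where "u \<in> U" "p \<in> U" "p \<noteq> u" "\<And>z. z \<in> U \<Longrightarrow> z \<noteq> p \<Longrightarrow> {u, z} \<notin> E"
proof -
  let ?E = "{e \<in> E. e \<subseteq> U}"
  have finU: "finite U" using sgraphD(1)[OF assms(1)] assms(2) finite_subset by blast
  have g: "sgraph U ?E" using sgraphD(4)[OF assms(1)] finU by (auto simp: sgraph_def)
  have "\<exists>u\<in>U. vdeg ?E u \<le> 1"
  proof (rule ccontr)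
    assume "\<not> ?thesis"
    then have "\<And>u. u \<in> U \<Longrightarrow> 2 \<le> vdeg ?E u" by force
    from sum_bounded_below[of U 2, OF this] have "card U * 2 \<le> (\<Sum>u\<in>U. vdeg ?E u)" by simp
    then show False using sum_vdeg[OF g] assms(3) by linarith
  qed
  then obtain u where u: "u \<in> U" "vdeg ?E u \<le> 1" by blast
  have e: "{u, z} \<in> ?E" if "z \<in> U" "{u, z} \<in> E" for z using that u by blast
  show ?thesis
  proof (cases "vdeg ?E u = 1")
    case True
    obtain p where p: "{u, p} \<in> ?E" "\<And>e. e \<in> ?E \<Longrightarrow> u \<in> e \<Longrightarrow> e = {u, p}"
      using vdeg_eq_1E[OF g True] by metis
    show ?thesis
    proof (rule that)
      show "u \<in> U" "p \<in> U" "p \<noteq> u" using u p(1) sgraph_neq[OF g p(1)] by auto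
      fix z assume z: "z \<in> U" "z \<noteq> p"
      show "{u, z} \<notin> E"
      proof
        assume "{u, z} \<in> E"
        then have "{u, z} = {u, p}" using e z p(2) by blast
        then show False using z by (auto simp: doubleton_eq_iff)
      qed
    qed
  next
    case False
    then have "vdeg ?E u = 0" using u by simp
    then have n: "{u, z} \<notin> E" if "z \<in> U" for z
      using vdeg_eq_0_iff[OF sgraphD(2)[OF g]] e[OF that] by blast
    have "card (U - {u}) \<noteq> 0" using u finU assms(4) by simp
    then obtain p where "p \<in> U - {u}" by (metis card.empty equals0I)
    then show ?thesis using that[of u p] u n by blast
  qed
qed

text \<open>With \<open>u\<close> nonadjacent to \<open>q\<close> and \<open>r\<close>, one of
  \<open>p q u r\<close> and \<open>p r u q\<close> is a path unless \<open>p\<close> is adjacent to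
  both \<open>q\<close> and \<open>r\<close>. Then \<open>q r u p\<close> is a path unless
  \<open>{q, r}\<close> or \<open>{p, u}\<close> is an edge, which gives a triangle or a star
  centred at \<open>p\<close>.\<close>

lemma nonadjacent_path_four:
  assumes "sgraph V E" "U \<subseteq> V" "card U = 4" "card {e \<in> E. e \<subseteq> U} \<le> 3"
  obtains (path) a b c d where "{a, b, c, d} \<subseteq> U" "nonadjacent_path E a b c d"
  | (dense) p q r where "{p, q, r} \<subseteq> U" "distinct [p, q, r]" "{p, q} \<in> E" "{p, r} \<in> E"
      "{q, r} \<in> E \<or> (\<exists>s\<in>U. s \<notin> {p, q, r} \<and> {p, s} \<in> E)"
proof -
  have "card {e \<in> E. e \<subseteq> U} < card U" "2 \<le> card U" using assms(3,4) by auto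
  then obtain u p where up: "u \<in> U" "p \<in> U" "p \<noteq> u" "\<And>z. z \<in> U \<Longrightarrow> z \<noteq> p \<Longrightarrow> {u, z} \<notin> E"
    using exists_sparse_vertex[OF assms(1,2)] by metis
  have "finite U" using assms(3) card.infinite by fastforce
  then have "card (U - {u, p}) = 2" using up assms(3) by simp
  then obtain q r where qr: "U - {u, p} = {q, r}" "q \<noteq> r" by (auto simp: card_2_iff)
  then have U: "q \<in> U" "r \<in> U" "q \<noteq> u" "q \<noteq> p" "r \<noteq> u" "r \<noteq> p" by blast+
  have n: "{u, q} \<notin> E" "{u, r} \<notin> E" using up(4) U by auto
  show ?thesis
  proof (cases "{p, q} \<in> E \<and> {p, r} \<in> E")
    case False
    then consider "{p, q} \<notin> E" | "{p, r} \<notin> E" by blast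
    then show ?thesis
    proof cases
      case 1
      then have "nonadjacent_path E p q u r"
        using n U qr up by (auto simp: nonadjacent_path_def insert_commute)
      then show ?thesis using path[of p q u r] U up by blast
    next
      case 2
      then have "nonadjacent_path E p r u q"
        using n U qr up by (auto simp: nonadjacent_path_def insert_commute)
      then show ?thesis using path[of p r u q] U up by blast
    qed
  next
    case True
    show ?thesis
    proof (cases "{q, r} \<in> E \<or> {p, u} \<in> E")
      case t: True
      show ?thesis
        by (rule dense[of p q r]) (use True t U up qr in auto)
    next
      case False
      then have "nonadjacent_path E q r u p"
        using n U qr up by (auto simp: nonadjacent_path_def insert_commute)
      then show ?thesis using path[of q r u p] U up by blast
    qed
  qed
qed

text \<open>The path is \<open>y q u r\<close>, where \<open>u\<close> is nonadjacent to everything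
  but \<open>p\<close>, so that only the end \<open>y\<close> may equal \<open>p\<close>. Four edges
  cannot make the four vertices other than \<open>u\<close> complete; of a nonadjacent pair among
  them, one member differs from \<open>p\<close> and becomes \<open>q\<close>.\<close>

lemma nonadjacent_path_five:
  assumes "sgraph V E" "U \<subseteq> V" "card U = 5" "card {e \<in> E. e \<subseteq> U} \<le> 4"
  obtains a b c d where "{a, b, c, d} \<subseteq> U" "nonadjacent_path E a b c d"
proof -
  let ?E = "{e \<in> E. e \<subseteq> U}"
  have "finite U" using assms(3) card.infinite by fastforce
  have g: "sgraph V ?E" using assms(1) by (rule sgraph_mono) auto
  have "card ?E < card U" "2 \<le> card U" using assms(3,4) by auto
  then obtain u p where up: "u \<in> U" "p \<in> U" "p \<noteq> u" "\<And>z. z \<in> U \<Longrightarrow> z \<noteq> p \<Longrightarrow> {u, z} \<notin> E"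
    using exists_sparse_vertex[OF assms(1,2)] by metis
  have "card (U - {u}) = 4" using up \<open>finite U\<close> assms(3) by simp
  then have "2 * card ?E < card (U - {u}) * (card (U - {u}) - 1)" using assms(4) by simp
  from exists_nonadjacent[OF g _ this] \<open>finite U\<close> obtain y' q' where
    "y' \<in> U - {u}" "q' \<in> U - {u}" "y' \<noteq> q'" "{y', q'} \<notin> E" by blast
  then obtain y q where yq: "y \<in> U - {u}" "q \<in> U - {u}" "y \<noteq> q" "{y, q} \<notin> E" "q \<noteq> p"
    by (metis insert_commute)
  have "card (U - {u, p, q, y}) \<noteq> 0"
  proof -
    have "card {u, p, q, y} \<le> 4" by (simp add: card_insert_if)
    then show ?thesis using diff_card_le_card_Diff[of "{u, p, q, y}" U] assms(3) by simp
  qed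
  then obtain r where r: "r \<in> U - {u, p, q, y}" by (metis card.empty equals0I)
  have "nonadjacent_path E y q u r"
    using yq r up(4)[of q] up(4)[of r] by (auto simp: nonadjacent_path_def insert_commute)
  then show ?thesis using that[of y q u r] yq r up by blast
qed

section \<open>A vertex of very large degree\<close>

lemma vdeg_le_Suc_vdeg_del_vertex:
  assumes "sgraph V E" "x \<noteq> y" shows "vdeg E y \<le> vdeg (del_vertex E x) y + 1"
proof -
  have "{e \<in> E. y \<in> e} \<subseteq> insert {x, y} {e \<in> del_vertex E x. y \<in> e}"
  proof
    fix e assume e: "e \<in> {e \<in> E. y \<in> e}"
    show "e \<in> insert {x, y} {e \<in> del_vertex E x. y \<in> e}"
    proof (cases "x \<in> e")
      case True
      obtain z where "e = {x, z}" using sgraph_edgeE[OF assms(1) _ True] e by blast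
      then show ?thesis using e assms(2) by auto
    qed (use e in \<open>auto simp: del_vertex_def\<close>)
  qed
  moreover have fin: "finite {e \<in> del_vertex E x. y \<in> e}"
    using sgraphD(2)[OF assms(1)] by (simp add: del_vertex_def)
  ultimately have "vdeg E y \<le> card (insert {x, y} {e \<in> del_vertex E x. y \<in> e})"
    unfolding vdeg_def by (intro card_mono) auto
  also have "\<dots> \<le> Suc (vdeg (del_vertex E x) y)"
    unfolding vdeg_def using fin by (simp add: card_insert_if)
  finally show ?thesis by simp
qed

lemma del_vertex_commute: "del_vertex (del_vertex E x) y = del_vertex (del_vertex E y) x"
  by (auto simp: del_vertex_def)

definition core_of :: "'a set set \<Rightarrow> 'a \<Rightarrow> 'a \<Rightarrow> 'a \<Rightarrow> 'a \<Rightarrow> 'a \<Rightarrow> bool" where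
  "core_of E v a b c d \<longleftrightarrow> nonadjacent_path E a b c d \<and> v \<notin> {a, b, c, d} \<and>
     {v, a} \<notin> E \<and> {v, b} \<notin> E \<and> {v, c} \<notin> E \<and> {v, d} \<notin> E"

text \<open>A vertex all of whose edges go to \<open>v\<close> may stand anywhere at distance at
  least three from \<open>v\<close>. Two such vertices close the cycle between \<open>d\<close> and
  \<open>a\<close>.\<close>

lemma packable_core:
  assumes "core_of E v a b c d" "distinct [y1, y2]" "{y1, y2} \<inter> {a, b, c, d, v} = {}"
    and "\<And>y e. y \<in> {y1, y2} \<Longrightarrow> e \<in> E \<Longrightarrow> y \<in> e \<Longrightarrow> v \<in> e"
  shows "packable {a, b, c, d, v, y1, y2} E"
proof -
  have y: "{y, z} \<notin> E" "{z, y} \<notin> E" if "y \<in> {y1, y2}" "z \<noteq> v" "y \<noteq> v" for y z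
    using assms(4)[OF that(1), of "{y, z}"] that(2,3) by (auto simp: insert_commute)
  have v: "{a, v} \<notin> E" "{b, v} \<notin> E" using assms(1) by (auto simp: core_of_def insert_commute)
  have "packable (set [a, b, v, c, d, y1, y2]) E"
    by (rule packable_list)
       (use assms(1-3) y v in \<open>auto simp: core_of_def nonadjacent_path_def\<close>)
  moreover have "set [a, b, v, c, d, y1, y2] = {a, b, c, d, v, y1, y2}" by auto
  ultimately show ?thesis by simp
qed

text \<open>The edges at \<open>x\<close> are arbitrary, so \<open>x\<close> is shielded by two of
  the harmless vertices on either side.\<close>

lemma packable_core_extra:
  assumes "core_of E v a b c d" "distinct [x, y1, y2, y3, y4]"
    and "{x, y1, y2, y3, y4} \<inter> {a, b, c, d, v} = {}"
    and "\<And>y e. y \<in> {y1, y2, y3, y4} \<Longrightarrow> e \<in> E \<Longrightarrow> y \<in> e \<Longrightarrow> v \<in> e"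
  shows "packable {a, b, c, d, v, x, y1, y2, y3, y4} E"
proof -
  have y: "{y, z} \<notin> E" "{z, y} \<notin> E" if "y \<in> {y1, y2, y3, y4}" "z \<noteq> v" "y \<noteq> v" for y z
    using assms(4)[OF that(1), of "{y, z}"] that(2,3) by (auto simp: insert_commute)
  have v: "{a, v} \<notin> E" "{b, v} \<notin> E" using assms(1) by (auto simp: core_of_def insert_commute)
  have "packable (set [a, b, v, c, d, y1, y2, x, y3, y4]) E"
    by (rule packable_list)
       (use assms(1-3) y v in \<open>auto simp: core_of_def nonadjacent_path_def\<close>)
  moreover have "set [a, b, v, c, d, y1, y2, x, y3, y4] = {a, b, c, d, v, x, y1, y2, y3, y4}" by auto
  ultimately show ?thesis by simp
qed

lemma obtain_distinct_list:
  assumes "k \<le> card S"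
  obtains ys where "length ys = k" "distinct ys" "set ys \<subseteq> S"
proof -
  obtain T where "T \<subseteq> S" "card T = k" "finite T" using obtain_subset_with_card_n[OF assms] by metis
  then show ?thesis using that finite_distinct_list[of T] distinct_card by metis
qed

lemma core_of_mono: "core_of E v a b c d \<Longrightarrow> E' \<subseteq> E \<Longrightarrow> core_of E' v a b c d"
  unfolding core_of_def nonadjacent_path_def by blast

text \<open>
  The vertices \<open>a b v c d\<close> are placed consecutively. The right-hand side \<open>14 + \<dots>\<close> keeps the cycle long
  enough to reinsert vertices that meet at most two edges besides the one to \<open>v\<close>.
\<close>

lemma packable_large_star:
  assumes "sgraph V E" "{a, b, c, d, v} \<subseteq> V" "core_of E v a b c d"
    and "card (del_vertex E v) \<le> 4" "card V \<ge> 14 + card (del_vertex E v)"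
  shows "packable V E"
  using assms
proof (induction "card V" arbitrary: V E rule: less_induct)
  case less
  note fin = sgraphD(1,2)[OF less.prems(1)]
  let ?B = "{a, b, c, d, v}"
  let ?E = "del_vertex E v"
  have finE: "finite ?E" using fin del_vertex_subset finite_subset by metis
  show ?case
  proof (cases "\<exists>x\<in>V - ?B. vdeg ?E x \<in> {1, 2}")
    case True
    then obtain x where x: "x \<in> V - ?B" "vdeg ?E x \<in> {1, 2}" by blast
    have r: "card (del_vertex ?E x) + vdeg ?E x = card ?E" by (rule card_del_vertex[OF finE])
    have c: "card (V - {x}) + 1 = card V" using card_Suc_Diff1[OF fin(1), of x] x by simp
    have "packable (V - {x}) (del_vertex E x)"
    proof (rule less.hyps)
      show "core_of (del_vertex E x) v a b c d"
        using less.prems(3) del_vertex_subset by (rule core_of_mono)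
      show "card (del_vertex (del_vertex E x) v) \<le> 4"
        "14 + card (del_vertex (del_vertex E x) v) \<le> card (V - {x})"
        using r x(2) c less.prems(4,5) unfolding del_vertex_commute[of E x v] by auto
    qed (use c x less.prems sgraph_del_vertex in auto)
    moreover have "vdeg E x \<le> 3"
      using vdeg_le_Suc_vdeg_del_vertex[OF less.prems(1), of v x] x by auto
    \<comment> \<open>Deleting a vertex of degree three requires \<open>4 * 3 < card V - 1\<close>.
      Since \<open>?E\<close> is nonempty here, the hypothesis gives one vertex more than
      14.\<close>
    moreover have "card V \<ge> 15" using r x(2) less.prems(5) by auto
    ultimately show ?thesis using x by (intro packable_delete_step[OF less.prems(1), of x]) auto
  next
    case False
    define X where "X = {x \<in> V - ?B. vdeg ?E x \<noteq> 0}"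
    have X3: "vdeg ?E x \<ge> 3" if "x \<in> X" for x
    proof -
      have "vdeg ?E x \<noteq> 0" "vdeg ?E x \<noteq> 1" "vdeg ?E x \<noteq> 2" using that False by (auto simp: X_def)
      then show ?thesis by arith
    qed
    \<comment> \<open>Two vertices of degree at least three in \<open>?E\<close> would account for
      \<open>3 + 3 - 1 = 5\<close> edges, but there are at most four.\<close>
    have uniq: "x = x'" if "x \<in> X" "x' \<in> X" for x x'
    proof (rule ccontr)
      assume "x \<noteq> x'"
      have "sgraph V ?E" using less.prems(1) del_vertex_subset by (rule sgraph_mono)
      then have "vdeg ?E x' \<le> vdeg (del_vertex ?E x) x' + 1"
        using \<open>x \<noteq> x'\<close> by (rule vdeg_le_Suc_vdeg_del_vertex)
      moreover have "finite (del_vertex ?E x)" using finE del_vertex_subset finite_subset by metis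
      moreover have "card (del_vertex ?E x) + vdeg ?E x = card ?E" by (rule card_del_vertex[OF finE])
      ultimately show False using X3[OF that(1)] X3[OF that(2)] less.prems(4)
        card_del_vertex[of "del_vertex ?E x" x'] by linarith
    qed
    define Y where "Y = V - ?B - X"
    have Y0: "v \<in> e" if "y \<in> Y" "e \<in> E" "y \<in> e" for y e
    proof (rule ccontr)
      assume "v \<notin> e"
      then have "e \<in> ?E" using that by (simp add: del_vertex_def)
      moreover have "vdeg ?E y = 0" using that by (auto simp: Y_def X_def)
      ultimately show False using that vdeg_eq_0_iff[OF finE] by blast
    qed
    have Y1: "vdeg E y \<le> 1" if "y \<in> Y" for y
    proof -
      have "vdeg ?E y = 0" "v \<noteq> y" using that by (auto simp: Y_def X_def)
      then show ?thesis using vdeg_le_Suc_vdeg_del_vertex[OF less.prems(1), of v y] by simp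
    qed
    have "card X \<le> 1"
    proof (cases "X = {}")
      case False
      then obtain x where "x \<in> X" by blast
      then have "X \<subseteq> {x}" using uniq by blast
      then show ?thesis using card_mono[of "{x}" X] by simp
    qed simp
    moreover have "finite X" using fin by (simp add: X_def)
    moreover have "card ?B \<le> 5" by (simp add: card_insert_if)
    ultimately have "card (?B \<union> X) \<le> 6" using card_Un_le[of ?B X] by linarith
    moreover have "Y = V - (?B \<union> X)" by (auto simp: Y_def)
    ultimately have "4 \<le> card Y"
      using diff_card_le_card_Diff[of "?B \<union> X" V] \<open>finite X\<close> less.prems(5) by simp
    then obtain ys where "length ys = 4" and ys: "distinct ys" "set ys \<subseteq> Y"
      using obtain_distinct_list by metis
    then obtain y1 y2 y3 y4 where ys4: "ys = [y1, y2, y3, y4]"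
      by (auto simp: length_Suc_conv numeral_eq_Suc)
    have YB: "Y \<inter> ?B = {}" "Y \<inter> X = {}" "Y \<subseteq> V" "X \<inter> ?B = {}" "X \<subseteq> V"
      by (auto simp: Y_def X_def)
    have B5: "card ?B = 5"
      using less.prems(3) by (auto simp: core_of_def nonadjacent_path_def)
    show ?thesis
    proof (cases "X = {}")
      case True
      have "packable {a, b, c, d, v, y1, y2} E"
        using less.prems(3) ys YB Y0 unfolding ys4 by (intro packable_core) auto
      then show ?thesis
      proof (rule packable_extend[OF less.prems(1)])
        show "{a, b, c, d, v, y1, y2} \<subseteq> V" using less.prems(2) ys YB unfolding ys4 by auto
        show "5 \<le> card {a, b, c, d, v, y1, y2}"
          unfolding B5[symmetric] by (intro card_mono) auto
        show "vdeg E x \<le> 1" if "x \<in> V - {a, b, c, d, v, y1, y2}" for x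
          using that True by (intro Y1) (auto simp: Y_def)
      qed
    next
      case False
      then obtain x where x: "x \<in> X" by blast
      have "packable {a, b, c, d, v, x, y1, y2, y3, y4} E"
      proof (rule packable_core_extra[OF less.prems(3)])
        show "distinct [x, y1, y2, y3, y4]" using ys x YB unfolding ys4 by auto
        show "{x, y1, y2, y3, y4} \<inter> {a, b, c, d, v} = {}"
        proof -
          have "set ys \<inter> ?B = {}" "x \<notin> ?B" using ys(2) x YB(1,4) by blast+
          then show ?thesis unfolding ys4 by simp
        qed
      qed (use ys Y0 in \<open>auto simp: ys4\<close>)
      then show ?thesis
      proof (rule packable_extend[OF less.prems(1)])
        show "{a, b, c, d, v, x, y1, y2, y3, y4} \<subseteq> V"
          using less.prems(2) ys YB x unfolding ys4 by auto
        show "5 \<le> card {a, b, c, d, v, x, y1, y2, y3, y4}"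
          unfolding B5[symmetric] by (intro card_mono) auto
        show "vdeg E z \<le> 1" if "z \<in> V - {a, b, c, d, v, x, y1, y2, y3, y4}" for z
          using that uniq[OF x] by (intro Y1) (auto simp: Y_def)
      qed
    qed
  qed
qed

text \<open>When \<open>v\<close> has degree \<open>card V - 5\<close>, the two alternatives, a
  triangle \<open>p q r\<close> or a star centred at \<open>p\<close>, are the two exceptional
  graphs with a second component.\<close>

definition dense_nonneighbours :: "'a set \<Rightarrow> 'a set set \<Rightarrow> 'a \<Rightarrow> bool" where
  "dense_nonneighbours V E v \<longleftrightarrow> (\<exists>p q r. {p, q, r} \<subseteq> V \<and> distinct [v, p, q, r] \<and>
     {v, p} \<notin> E \<and> {v, q} \<notin> E \<and> {v, r} \<notin> E \<and> {p, q} \<in> E \<and> {p, r} \<in> E \<and>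
     ({q, r} \<in> E \<or> (\<exists>s\<in>V. s \<notin> {v, p, q, r} \<and> {v, s} \<notin> E \<and> {p, s} \<in> E)))"

lemma card_nonneighbours:
  assumes "sgraph V E" "v \<in> V"
  shows "card {x \<in> V - {v}. {v, x} \<notin> E} + vdeg E v + 1 = card V"
proof -
  let ?N = "{x \<in> V. {v, x} \<in> E}" and ?U = "{x \<in> V - {v}. {v, x} \<notin> E}"
  have "finite V" using assms(1) by (rule sgraphD)
  have "V = insert v (?U \<union> ?N)" using assms(2) by auto
  then have "card V = card (insert v (?U \<union> ?N))" by simp
  also have "\<dots> = Suc (card (?U \<union> ?N))"
    using \<open>finite V\<close> sgraph_neq(1)[OF assms(1), of v v] by (subst card_insert_disjoint) auto
  also have "card (?U \<union> ?N) = card ?U + card ?N"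
    using \<open>finite V\<close> by (intro card_Un_disjoint) auto
  finally show ?thesis by (simp add: vdeg_eq_card_nbrs[OF assms(1)])
qed

lemma packable_near_star:
  assumes "sgraph V E" "card V \<ge> 18" "card E + 2 \<le> card V" "v \<in> V"
    and "card V \<le> vdeg E v + 6" "vdeg E v + 5 \<le> card V"
    and "vdeg E v + 5 = card V \<Longrightarrow> \<not> dense_nonneighbours V E v"
  shows "packable V E"
proof -
  note fin = sgraphD(1,2)[OF assms(1)]
  define U where "U = {x \<in> V - {v}. {v, x} \<notin> E}"
  have U: "card U + vdeg E v + 1 = card V" "U \<subseteq> V"
    using card_nonneighbours[OF assms(1,4)] by (auto simp: U_def)
  have q: "card (del_vertex E v) + vdeg E v = card E" by (rule card_del_vertex[OF fin(2)])
  have "card {e \<in> E. e \<subseteq> U} \<le> card (del_vertex E v)"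
    using fin(2) by (intro card_mono) (auto simp: del_vertex_def U_def)
  \<comment> \<open>Edges inside \<open>U\<close> avoid \<open>v\<close>, and
    \<open>(n - 2) - vdeg E v = card U - 1\<close>.\<close>
  then have EU: "card {e \<in> E. e \<subseteq> U} + 1 \<le> card U" using q U(1) assms(3) by linarith
  have "\<exists>a b c d. {a, b, c, d} \<subseteq> U \<and> nonadjacent_path E a b c d"
  proof (cases "card U = 4")
    case True
    then have "card {e \<in> E. e \<subseteq> U} \<le> 3" using EU by simp
    with assms(1) U(2) True show ?thesis
    proof (cases rule: nonadjacent_path_four)
      case (dense p q r)
      have "dense_nonneighbours V E v" unfolding dense_nonneighbours_def
        by (rule exI[of _ p], rule exI[of _ q], rule exI[of _ r])
           (use dense in \<open>auto simp: U_def\<close>)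
      then show ?thesis using assms(7) True U(1) by simp
    qed blast
  next
    case False
    then have "card U = 5" using U(1) assms(5,6) by linarith
    moreover from this have "card {e \<in> E. e \<subseteq> U} \<le> 4" using EU by simp
    ultimately show ?thesis using nonadjacent_path_five[OF assms(1) U(2)] by metis
  qed
  then obtain a b c d where abcd: "{a, b, c, d} \<subseteq> U" "nonadjacent_path E a b c d" by blast
  show ?thesis
  proof (rule packable_large_star[OF assms(1)])
    show "core_of E v a b c d" using abcd by (auto simp: core_of_def U_def)
    show "{a, b, c, d, v} \<subseteq> V" using abcd U(2) assms(4) by blast
    \<comment> \<open>At most \<open>(n - 2) - (n - 6) = 4\<close> edges avoid \<open>v\<close>, and
      \<open>14 + 4 = 18\<close>.\<close>
    show "card (del_vertex E v) \<le> 4" "14 + card (del_vertex E v) \<le> card V"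
      using q assms(2,3,5) by linarith+
  qed
qed

section \<open>Few isolated vertices\<close>

text \<open>Greedy choice: \<open>F\<close> is a common pool from which every \<open>Y i\<close> is
  filled up to \<open>s\<close> elements. By truncated subtraction \<open>s - card (Y i)\<close> is
  the deficit of \<open>Y i\<close>, and a surplus elsewhere gives no credit.\<close>

lemma select_disjoint:
  fixes Y :: "nat \<Rightarrow> 'a set"
  assumes "\<And>i. i < k \<Longrightarrow> finite (Y i)" "finite F" "(\<Sum>i<k. s - card (Y i)) \<le> card F"
    and "\<And>i. i < k \<Longrightarrow> Y i \<inter> F = {}" "\<And>i j. i < k \<Longrightarrow> j < k \<Longrightarrow> i \<noteq> j \<Longrightarrow> Y i \<inter> Y j = {}"
  shows "\<exists>S. (\<forall>i<k. S i \<subseteq> Y i \<union> F \<and> card (S i) = s) \<and>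
    (\<forall>i<k. \<forall>j<k. i \<noteq> j \<longrightarrow> S i \<inter> S j = {})"
  using assms
proof (induction k arbitrary: F)
    case (Suc k)
    have "s - card (Y k) \<le> card F" using Suc.prems(3) by simp
    then obtain T where T: "T \<subseteq> F" "card T = s - card (Y k)" "finite T"
      using obtain_subset_with_card_n by metis
    have "Y k \<inter> T = {}" using T(1) Suc.prems(4)[of k] by blast
    then have "card (Y k \<union> T) = card (Y k) + card T"
      using T(3) Suc.prems(1)[of k] by (intro card_Un_disjoint) auto
    then have "s \<le> card (Y k \<union> T)" using T(2) by simp
    then obtain Sk where Sk: "Sk \<subseteq> Y k \<union> T" "card Sk = s" using obtain_subset_with_card_n by metis
    have "card (F - T) = card F - card T" using T by (intro card_Diff_subset)
    then have sum: "(\<Sum>i<k. s - card (Y i)) \<le> card (F - T)" using Suc.prems(3) T(2) by simp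
    have "\<exists>S. (\<forall>i<k. S i \<subseteq> Y i \<union> (F - T) \<and> card (S i) = s) \<and>
      (\<forall>i<k. \<forall>j<k. i \<noteq> j \<longrightarrow> S i \<inter> S j = {})"
    proof (rule Suc.IH[OF _ _ sum])
      show "finite (F - T)" using Suc.prems(2) by simp
      show "Y i \<inter> (F - T) = {}" if "i < k" for i using Suc.prems(4)[of i] that by auto
      show "finite (Y i)" if "i < k" for i using Suc.prems(1)[of i] that by simp
      show "Y i \<inter> Y j = {}" if "i < k" "j < k" "i \<noteq> j" for i j
        using Suc.prems(5)[of i j] that by simp
    qed
    then obtain S where "(\<forall>i<k. S i \<subseteq> Y i \<union> (F - T) \<and> card (S i) = s) \<and>
      (\<forall>i<k. \<forall>j<k. i \<noteq> j \<longrightarrow> S i \<inter> S j = {})" ..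
    then have S: "\<And>i. i < k \<Longrightarrow> S i \<subseteq> Y i \<union> (F - T)" "\<And>i. i < k \<Longrightarrow> card (S i) = s"
      "\<And>i j. i < k \<Longrightarrow> j < k \<Longrightarrow> i \<noteq> j \<Longrightarrow> S i \<inter> S j = {}" by simp_all
    have d: "S i \<inter> Sk = {}" if "i < k" for i
    proof -
      have "Y i \<inter> Y k = {}" "Y i \<inter> F = {}" "Y k \<inter> F = {}"
        using that Suc.prems(4)[of i] Suc.prems(4)[of k] Suc.prems(5)[of i k] by auto
      then show ?thesis using S(1)[OF that] Sk(1) T(1) by blast
    qed
    show ?case
    proof (rule exI[of _ "S(k := Sk)"], intro conjI allI impI)
      fix i assume i: "i < Suc k"
      show "(S(k := Sk)) i \<subseteq> Y i \<union> F"
      proof (cases "i = k")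
        case True
        then show ?thesis using Sk(1) T(1) by auto
      next
        case False
        then show ?thesis using S(1)[of i] i by auto
      qed
      show "card ((S(k := Sk)) i) = s" using Sk(2) S(2)[of i] i by (cases "i = k") auto
    next
      fix i j assume ij: "i < Suc k" "j < Suc k" "i \<noteq> j"
      show "(S(k := Sk)) i \<inter> (S(k := Sk)) j = {}"
        using ij S(3)[of i j] d[of i] d[of j] by (cases "i = k"; cases "j = k") auto
    qed
qed simp

text \<open>The last hypothesis is a degree count: \<open>k\<close> vertices of degree at least
  \<open>(n + 2) div 4\<close>, at most three isolated vertices, and degree at least one for the
  other vertices.\<close>

lemma sparse_stuck_numeric:
  fixes n m k :: nat
  assumes "n \<le> 18" "m + 20 \<le> 2 * n" "k * ((n + 2) div 4) + n \<le> 2 * m + k + 3"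
  shows "n \<ge> 13 \<and> (k = 0 \<or> k = 1 \<or> k = 2 \<and> n \<ge> 15 \<or> k = 3 \<and> n \<ge> 16 \<or> k = 4 \<and> n \<ge> 17)"
proof -
  have "n \<ge> 10" using assms(2) by simp
  then have "n \<in> {10,11,12,13,14,15,16,17,18}" using assms(1) by simp presburger
  then show ?thesis using assms(2,3) by (elim insertE emptyE; simp; arith)
qed

lemma vdeg_le_1_unique:
  assumes "sgraph V E" "vdeg E x \<le> 1" "{x, y} \<in> E" "{x, z} \<in> E" shows "y = z"
proof (rule ccontr)
  assume "y \<noteq> z"
  then have "{x, y} \<noteq> {x, z}" by (auto simp: doubleton_eq_iff)
  then have "2 = card {{x, y}, {x, z}}" by simp
  also have "\<dots> \<le> vdeg E x" unfolding vdeg_def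
    using sgraphD(2)[OF assms(1)] assms(3,4) by (intro card_mono) auto
  finally show False using assms(2) by simp
qed

text \<open>
  \<open>Y i\<close> is the set of leaves at \<open>v i\<close>; \<open>F\<close> consists of the isolated vertices and one end of each
  isolated edge; \<open>a i\<close> and \<open>e\<close> are the degree of \<open>v i\<close> and the number of edges inside the set of
  the \<open>v j\<close>.
\<close>

lemma large_vertices_structure:
  fixes v :: "nat \<Rightarrow> 'a"
  assumes "sgraph V E" "inj_on v {..<k}" "v ` {..<k} \<subseteq> V"
    and "\<And>x. x \<in> V - v ` {..<k} \<Longrightarrow> vdeg E x \<le> 1"
  obtains Y F a e where
    "\<And>i. i < k \<Longrightarrow> finite (Y i)" "finite F" "\<And>i. i < k \<Longrightarrow> Y i \<inter> F = {}"
    "\<And>i j. i < k \<Longrightarrow> j < k \<Longrightarrow> i \<noteq> j \<Longrightarrow> Y i \<inter> Y j = {}"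
    "\<And>i. i < k \<Longrightarrow> Y i \<union> F \<subseteq> V - v ` {..<k}"
    "\<And>i. i < k \<Longrightarrow> a i + card (Y i) = vdeg E (v i)" "\<And>i. i < k \<Longrightarrow> a i < k"
    "(\<Sum>i<k. a i) = 2 * e" "card V + e \<le> card F + k + card E"
    "\<And>i j s. i < k \<Longrightarrow> j < k \<Longrightarrow> i \<noteq> j \<Longrightarrow> s \<in> Y i \<union> F \<Longrightarrow> {v j, s} \<notin> E"
    "\<And>i j s s'. i < k \<Longrightarrow> j < k \<Longrightarrow> s \<in> Y i \<union> F \<Longrightarrow> s' \<in> Y j \<union> F \<Longrightarrow> {s, s'} \<notin> E"
proof -
  define L where "L = v ` {..<k}"
  define Y where "Y = (\<lambda>i. {x \<in> V - L. {v i, x} \<in> E})"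
  define F0 where "F0 = V - L - (\<Union>i<k. Y i)"
  note fin = sgraphD(1,2)[OF assms(1)]
  have finL: "finite L" and kL: "card L = k" and LV: "L \<subseteq> V"
    using assms(2,3) by (auto simp: L_def card_image)
  have finY: "finite (Y i)" for i using fin by (simp add: Y_def)
  have finF0: "finite F0" using fin by (simp add: F0_def)
  obtain F where F: "F \<subseteq> F0" "\<And>e. e \<in> E \<Longrightarrow> \<not> e \<subseteq> F" "card F0 \<le> card F + card {e \<in> E. e \<subseteq> F0}"
    using exists_independent[OF assms(1) finF0] by blast
  have finF: "finite F" using F(1) finF0 finite_subset by blast
  have uniq: "y = z" if "x \<in> V - L" "{x, y} \<in> E" "{x, z} \<in> E" for x y z
    using vdeg_le_1_unique[OF assms(1) _ that(2,3)] assms(4) that(1) by (simp add: L_def)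
  have vL: "v i \<in> L" if "i < k" for i using that by (simp add: L_def)
  have Yn: "z = v i" if "x \<in> Y i" "{x, z} \<in> E" for x i z
    using uniq[of x z "v i"] that by (auto simp: Y_def insert_commute)
  have Ydis: "Y i \<inter> Y j = {}" if "i < k" "j < k" "i \<noteq> j" for i j
  proof (rule ccontr)
    assume "Y i \<inter> Y j \<noteq> {}"
    then obtain x where "x \<in> Y i" "x \<in> Y j" by blast
    then have "{x, v j} \<in> E" by (simp add: Y_def insert_commute)
    then have "v j = v i" using \<open>x \<in> Y i\<close> by (intro Yn)
    then show False using inj_onD[OF assms(2), of j i] that by simp
  qed
  \<comment> \<open>Edges inside \<open>L\<close>, edges outside \<open>L\<close>, and edges from
    \<open>L\<close> to leaves. Each leaf edge uses up one vertex outside \<open>L\<close>, and each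
    edge of \<open>?B\<close> costs at most one vertex of \<open>F0\<close>. Hence
    \<open>card F\<close> is at least \<open>card V - k\<close> minus the number of edges that are
    not in \<open>?A\<close>.\<close>
  let ?A = "{e \<in> E. e \<subseteq> L}" and ?B = "{e \<in> E. e \<subseteq> V - L}"
  let ?C = "(\<lambda>(i, x). {v i, x}) ` (SIGMA i:{..<k}. Y i)"
  have "inj_on (\<lambda>(i, x). {v i, x}) (SIGMA i:{..<k}. Y i)"
  proof (rule inj_onI, clarify)
    fix i x j x' assume *: "i < k" "x \<in> Y i" "j < k" "x' \<in> Y j" "{v i, x} = {v j, x'}"
    have "x \<noteq> v j" "x' \<noteq> v i" using * vL by (auto simp: Y_def)
    then have "v i = v j" "x = x'" using *(5) by (auto simp: doubleton_eq_iff)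
    then show "i = j \<and> x = x'" using inj_onD[OF assms(2), of i j] * by simp
  qed
  then have cardC: "card ?C = (\<Sum>i<k. card (Y i))"
    using finY by (simp add: card_image)
  have C: "c \<in> E \<and> \<not> c \<subseteq> L \<and> \<not> c \<subseteq> V - L" if c: "c \<in> ?C" for c
  proof -
    obtain i x where "i < k" "x \<in> Y i" "c = {v i, x}" using c by auto
    then show ?thesis using vL[of i] by (auto simp: Y_def)
  qed
  have ne: "c \<noteq> {}" if "c \<in> E" for c using sgraphD(4)[OF assms(1) that] by auto
  have AB: "?A \<inter> ?B = {}" using ne by blast
  have ABC: "(?A \<union> ?B) \<inter> ?C = {}" using C by blast
  have finC: "finite ?C" using finY by auto
  have "card ?A + card ?B + card ?C = card (?A \<union> ?B \<union> ?C)"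
    using fin(2) AB ABC finC by (simp add: card_Un_disjoint)
  also have "\<dots> \<le> card E" using C fin(2) by (intro card_mono) auto
  finally have m: "card ?A + card ?B + (\<Sum>i<k. card (Y i)) \<le> card E" using cardC by simp
  have "card (\<Union>i<k. Y i) = (\<Sum>i<k. card (Y i))"
    using finY Ydis by (intro card_UN_disjoint) auto
  moreover have "card F0 = card (V - L) - card (\<Union>i<k. Y i)"
    unfolding F0_def using finY by (intro card_Diff_subset) (auto simp: Y_def)
  moreover have "card (V - L) = card V - k" using kL finL LV by (simp add: card_Diff_subset)
  moreover have "card (\<Union>i<k. Y i) \<le> card (V - L)"
    using fin by (intro card_mono) (auto simp: Y_def)
  moreover have "k \<le> card V" using card_mono[OF fin(1) LV] kL by simp
  ultimately have n: "card F0 + (\<Sum>i<k. card (Y i)) + k = card V" by linarith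
  have "card {e \<in> E. e \<subseteq> F0} \<le> card ?B" using fin(2) by (intro card_mono) (auto simp: F0_def)
  then have f: "card V + card ?A \<le> card F + k + card E" using n m F(3) by linarith
  have gA: "sgraph L ?A" using assms(1) finL by (auto simp: sgraph_def)
  have sum_a: "(\<Sum>i<k. vdeg ?A (v i)) = 2 * card ?A"
    using sum_vdeg[OF gA] by (simp add: L_def sum.reindex[OF assms(2)])
  have deg: "vdeg ?A (v i) + card (Y i) = vdeg E (v i)" if i: "i < k" for i
  proof -
    have N: "{y \<in> V. {v i, y} \<in> E} = {y \<in> L. {v i, y} \<in> ?A} \<union> Y i"
      using LV vL[OF i] by (auto simp: Y_def)
    have "card ({y \<in> L. {v i, y} \<in> ?A} \<union> Y i) = card {y \<in> L. {v i, y} \<in> ?A} + card (Y i)"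
      using finL finY by (intro card_Un_disjoint) (auto simp: Y_def)
    then show ?thesis
      unfolding vdeg_eq_card_nbrs[OF assms(1), of "v i"] vdeg_eq_card_nbrs[OF gA, of "v i"] N by simp
  qed
  have ak: "vdeg ?A (v i) < k" if i: "i < k" for i
  proof -
    have "vdeg ?A (v i) \<le> card (L - {v i})"
      unfolding vdeg_eq_card_nbrs[OF gA] using finL sgraph_neq(1)[OF gA, of "v i"]
      by (intro card_mono) auto
    then show ?thesis using vL[OF i] kL finL i by simp
  qed
  have YF: "Y i \<inter> F = {}" if "i < k" for i using F(1) that by (auto simp: F0_def)
  have sub: "Y i \<union> F \<subseteq> V - L" for i using F(1) by (auto simp: F0_def Y_def)
  have adj1: "{v j, s} \<notin> E" if "i < k" "j < k" "i \<noteq> j" "s \<in> Y i \<union> F" for i j s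
  proof
    assume *: "{v j, s} \<in> E"
    then have "s \<in> Y j" using that(4) sub[of i] by (auto simp: Y_def)
    then show False using that YF[of j] Ydis[of i j] by blast
  qed
  have adj2: "{s, s'} \<notin> E" if "i < k" "j < k" "s \<in> Y i \<union> F" "s' \<in> Y j \<union> F" for i j s s'
  proof
    assume *: "{s, s'} \<in> E"
    have nL: "s \<notin> L" "s' \<notin> L" using that sub by blast+
    have "{s', s} \<in> E" using * by (simp add: insert_commute)
    then have "s \<notin> Y i" "s' \<notin> Y j"
      using Yn[of s i s'] Yn[of s' j s] * nL vL[OF that(1)] vL[OF that(2)] by auto
    then have "{s, s'} \<subseteq> F" using that(3,4) by blast
    then show False using F(2)[OF *] by blast
  qed
  show ?thesis
    by (rule that[of Y F "\<lambda>i. vdeg ?A (v i)" "card ?A"])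
       (use finY finF YF Ydis sub deg ak sum_a f adj1 adj2 in \<open>auto simp: L_def\<close>)
qed

section \<open>Explicit cycles around two, three or four large vertices\<close>

lemma card_eq_4_imp: "card S = 4 \<Longrightarrow> \<exists>a b c d. S = {a, b, c, d} \<and> distinct [a, b, c, d]"
proof -
  assume S: "card S = 4"
  then have "finite S" using card.infinite by fastforce
  then obtain xs where xs: "set xs = S" "distinct xs" using finite_distinct_list by blast
  then have "length xs = 4" using S distinct_card by fastforce
  then obtain a b c d where "xs = [a, b, c, d]" by (auto simp: length_Suc_conv numeral_eq_Suc)
  then show ?thesis using xs by force
qed

text \<open>\<open>P\<close> plays the role of leaves at \<open>v0\<close> and \<open>Q\<close> of
  leaves at \<open>v1\<close>. Each of \<open>v0\<close> and \<open>v1\<close> is surrounded by the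
  set of the other one, which takes four separators from that set.\<close>

lemma packable_two_large:
  assumes "card P = 4" "card Q = 4" "P \<inter> Q = {}" "v0 \<noteq> v1" "{v0, v1} \<inter> (P \<union> Q) = {}"
    and "\<And>s. s \<in> Q \<Longrightarrow> {v0, s} \<notin> E" "\<And>s. s \<in> P \<Longrightarrow> {v1, s} \<notin> E"
    and "\<And>s s'. s \<in> P \<union> Q \<Longrightarrow> s' \<in> P \<union> Q \<Longrightarrow> {s, s'} \<notin> E"
  shows "packable ({v0, v1} \<union> P \<union> Q) E"
proof -
  obtain p1 p2 p3 p4 where P: "P = {p1, p2, p3, p4}" "distinct [p1, p2, p3, p4]"
    using card_eq_4_imp[OF assms(1)] by blast
  obtain q1 q2 q3 q4 where Q: "Q = {q1, q2, q3, q4}" "distinct [q1, q2, q3, q4]"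
    using card_eq_4_imp[OF assms(2)] by blast
  have v: "{s, v0} \<notin> E" if "s \<in> Q" for s using assms(6)[OF that] by (simp add: insert_commute)
  have w: "{s, v1} \<notin> E" if "s \<in> P" for s using assms(7)[OF that] by (simp add: insert_commute)
  have "packable (set [v0, q1, q2, p1, p2, v1, p3, p4, q3, q4]) E"
    by (rule packable_list) (use assms(3-8) v w P Q in auto)
  moreover have "set [v0, q1, q2, p1, p2, v1, p3, p4, q3, q4] = {v0, v1} \<union> P \<union> Q"
    using P Q by auto
  ultimately show ?thesis by metis
qed

text \<open>\<open>P\<close>, \<open>Q\<close>, \<open>R\<close> belong to \<open>v0\<close>,
  \<open>v1\<close>, \<open>v2\<close>. Between two large vertices stands the pair of the third, so
  two separators from each set suffice.\<close>

lemma packable_three_large: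
  assumes "card P = 2" "card Q = 2" "card R = 2" "P \<inter> Q = {}" "P \<inter> R = {}" "Q \<inter> R = {}"
    and "distinct [v0, v1, v2]" "{v0, v1, v2} \<inter> (P \<union> Q \<union> R) = {}"
    and "\<And>s. s \<in> Q \<union> R \<Longrightarrow> {v0, s} \<notin> E" "\<And>s. s \<in> P \<union> R \<Longrightarrow> {v1, s} \<notin> E"
      "\<And>s. s \<in> P \<union> Q \<Longrightarrow> {v2, s} \<notin> E"
    and "\<And>s s'. s \<in> P \<union> Q \<union> R \<Longrightarrow> s' \<in> P \<union> Q \<union> R \<Longrightarrow> {s, s'} \<notin> E"
  shows "packable ({v0, v1, v2} \<union> P \<union> Q \<union> R) E"
proof -
  obtain p1 p2 q1 q2 r1 r2 where PQ: "P = {p1, p2}" "p1 \<noteq> p2" "Q = {q1, q2}" "q1 \<noteq> q2"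
    "R = {r1, r2}" "r1 \<noteq> r2" using assms(1-3) by (auto simp: card_2_iff)
  have v: "{s, v0} \<notin> E" if "s \<in> Q \<union> R" for s using assms(9)[OF that] by (simp add: insert_commute)
  have w: "{s, v1} \<notin> E" if "s \<in> P \<union> R" for s using assms(10)[OF that] by (simp add: insert_commute)
  have u: "{s, v2} \<notin> E" if "s \<in> P \<union> Q" for s using assms(11)[OF that] by (simp add: insert_commute)
  have "packable (set [v0, r1, r2, v1, p1, p2, v2, q1, q2]) E"
    by (rule packable_list) (use assms(4-12) v w u PQ in auto)
  moreover have "set [v0, r1, r2, v1, p1, p2, v2, q1, q2] = {v0, v1, v2} \<union> P \<union> Q \<union> R"
    using PQ by auto
  ultimately show ?thesis by metis
qed

text \<open>In the cyclic order \<open>v0 R v1 T v2 P v3 Q\<close> every large vertex is opposite to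
  its own pair, which is thus never next to it.\<close>

lemma packable_four_large:
  assumes "card P = 2" "card Q = 2" "card R = 2" "card T = 2"
    and "P \<inter> Q = {}" "P \<inter> R = {}" "Q \<inter> R = {}" "P \<inter> T = {}" "Q \<inter> T = {}" "R \<inter> T = {}"
    and "distinct [v0, v1, v2, v3]" "{v0, v1, v2, v3} \<inter> (P \<union> Q \<union> R \<union> T) = {}"
    and "\<And>s. s \<in> Q \<union> R \<Longrightarrow> {v0, s} \<notin> E" "\<And>s. s \<in> R \<union> T \<Longrightarrow> {v1, s} \<notin> E"
      "\<And>s. s \<in> P \<union> T \<Longrightarrow> {v2, s} \<notin> E" "\<And>s. s \<in> P \<union> Q \<Longrightarrow> {v3, s} \<notin> E"
    and "\<And>s s'. s \<in> P \<union> Q \<union> R \<union> T \<Longrightarrow> s' \<in> P \<union> Q \<union> R \<union> T \<Longrightarrow> {s, s'} \<notin> E"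
  shows "packable ({v0, v1, v2, v3} \<union> P \<union> Q \<union> R \<union> T) E"
proof -
  obtain p1 p2 q1 q2 r1 r2 t1 t2 where PQ: "P = {p1, p2}" "p1 \<noteq> p2" "Q = {q1, q2}" "q1 \<noteq> q2"
    "R = {r1, r2}" "r1 \<noteq> r2" "T = {t1, t2}" "t1 \<noteq> t2" using assms(1-4) by (auto simp: card_2_iff)
  have v: "{s, v0} \<notin> E" if "s \<in> Q \<union> R" for s using assms(13)[OF that] by (simp add: insert_commute)
  have w: "{s, v1} \<notin> E" if "s \<in> R \<union> T" for s using assms(14)[OF that] by (simp add: insert_commute)
  have u: "{s, v2} \<notin> E" if "s \<in> P \<union> T" for s using assms(15)[OF that] by (simp add: insert_commute)
  have x: "{s, v3} \<notin> E" if "s \<in> P \<union> Q" for s using assms(16)[OF that] by (simp add: insert_commute)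
  have "packable (set [v0, r1, r2, v1, t1, t2, v2, p1, p2, v3, q1, q2]) E"
    by (rule packable_list) (use assms(5-17) v w u x PQ in auto)
  moreover have "set [v0, r1, r2, v1, t1, t2, v2, p1, p2, v3, q1, q2] =
      {v0, v1, v2, v3} \<union> P \<union> Q \<union> R \<union> T"
    using PQ by auto
  ultimately show ?thesis by metis
qed

lemma packable_several_large:
  fixes v :: "nat \<Rightarrow> 'a"
  assumes "sgraph V E" "inj_on v {..<k}" "v ` {..<k} \<subseteq> V"
    and "\<And>x. x \<in> V - v ` {..<k} \<Longrightarrow> vdeg E x \<le> 1"
    and large: "\<And>i. i < k \<Longrightarrow> card V - 1 \<le> 4 * vdeg E (v i)"
    and n: "card V \<le> 18" "card E + 20 \<le> 2 * card V"
    and k: "k = 2 \<and> card V \<ge> 15 \<or> k = 3 \<and> card V \<ge> 16 \<or> k = 4 \<and> card V \<ge> 17"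
  shows "packable V E"
proof -
  obtain Y F a e where Y: "\<And>i. i < k \<Longrightarrow> finite (Y i)" "finite F" "\<And>i. i < k \<Longrightarrow> Y i \<inter> F = {}"
    "\<And>i j. i < k \<Longrightarrow> j < k \<Longrightarrow> i \<noteq> j \<Longrightarrow> Y i \<inter> Y j = {}"
    "\<And>i. i < k \<Longrightarrow> Y i \<union> F \<subseteq> V - v ` {..<k}"
    and a: "\<And>i. i < k \<Longrightarrow> a i + card (Y i) = vdeg E (v i)" "\<And>i. i < k \<Longrightarrow> a i < k"
    "(\<Sum>i<k. a i) = 2 * e" "card V + e \<le> card F + k + card E"
    and adj: "\<And>i j s. i < k \<Longrightarrow> j < k \<Longrightarrow> i \<noteq> j \<Longrightarrow> s \<in> Y i \<union> F \<Longrightarrow> {v j, s} \<notin> E"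
    "\<And>i j s s'. i < k \<Longrightarrow> j < k \<Longrightarrow> s \<in> Y i \<union> F \<Longrightarrow> s' \<in> Y j \<union> F \<Longrightarrow> {s, s'} \<notin> E"
    using large_vertices_structure[OF assms(1-4)] by blast
  define s :: nat where "s = (if k = 2 then 4 else 2)"
  have deg: "card V - 1 \<le> 4 * (a i + card (Y i))" "a i < k" if "i < k" for i
    using large[OF that] a(1,2)[OF that] by auto
  have sets: "{..<2::nat} = {0, 1}" "{..<3::nat} = {0, 1, 2}" "{..<4::nat} = {0, 1, 2, 3}" by auto
  \<comment> \<open>A large vertex has degree at least 4, and at least 5 if
    \<open>card V = 18\<close>; at most \<open>k - 1\<close> of its edges go to large vertices. If
    \<open>k = 3\<close> or \<open>card V = 18\<close>, its leaves alone suffice. Otherwise a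
    deficit can arise only from edges between large vertices, and \<open>a(4)\<close> raises the
    lower bound for \<open>card F\<close> by one for each of these edges.\<close>
  have sum: "(\<Sum>i<k. s - card (Y i)) \<le> card F"
    using k
  proof (elim disjE conjE)
    assume "k = 2" "card V \<ge> 15"
    then show ?thesis using deg[of 0] deg[of 1] a(3,4) n by (simp add: s_def sets; arith)
  next
    assume "k = 3" "card V \<ge> 16"
    then show ?thesis using deg[of 0] deg[of 1] deg[of 2] by (simp add: s_def sets; arith)
  next
    assume k4: "k = 4" "card V \<ge> 17"
    then consider "card V = 17" | "card V = 18" using n(1) by linarith
    then show ?thesis
    proof cases
      case 1
      then show ?thesis using k4 deg[of 0] deg[of 1] deg[of 2] deg[of 3] a(3,4) n
        by (simp add: s_def sets; arith)
    next
      case 2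
      then show ?thesis using k4 deg[of 0] deg[of 1] deg[of 2] deg[of 3]
        by (simp add: s_def sets; arith)
    qed
  qed
  obtain S where "(\<forall>i<k. S i \<subseteq> Y i \<union> F \<and> card (S i) = s) \<and>
    (\<forall>i<k. \<forall>j<k. i \<noteq> j \<longrightarrow> S i \<inter> S j = {})"
    using select_disjoint[OF Y(1,2) sum Y(3,4)] by blast
  then have S: "\<And>i. i < k \<Longrightarrow> S i \<subseteq> Y i \<union> F" "\<And>i. i < k \<Longrightarrow> card (S i) = s"
    "\<And>i j. i < k \<Longrightarrow> j < k \<Longrightarrow> i \<noteq> j \<Longrightarrow> S i \<inter> S j = {}" by simp_all
  have Sv: "S i \<inter> v ` {..<k} = {}" "S i \<subseteq> V" if "i < k" for i
    using S(1)[OF that] Y(5)[OF that] by blast+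
  have adj': "\<And>i j s. i < k \<Longrightarrow> j < k \<Longrightarrow> i \<noteq> j \<Longrightarrow> s \<in> S i \<Longrightarrow> {v j, s} \<notin> E"
    "\<And>i j s s'. i < k \<Longrightarrow> j < k \<Longrightarrow> s \<in> S i \<Longrightarrow> s' \<in> S j \<Longrightarrow> {s, s'} \<notin> E"
    using adj S(1) by blast+
  have inj: "v i \<noteq> v j" if "i < k" "j < k" "i \<noteq> j" for i j
    using inj_onD[OF assms(2), of i j] that by auto
  define B where "B = v ` {..<k} \<union> (\<Union>i<k. S i)"
  have S': "v i \<notin> S j" if "i < k" "j < k" for i j using Sv(1)[OF that(2)] that(1) by blast
  have ind: "{s, s'} \<notin> E" if "s \<in> (\<Union>i<k. S i)" "s' \<in> (\<Union>i<k. S i)" for s s'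
    using adj'(2) that by blast
  have "packable B E"
    using k
  proof (elim disjE conjE)
    assume k: "k = 2"
    have B: "B = {v 0, v 1} \<union> S 0 \<union> S 1" using k by (auto simp: B_def sets)
    show ?thesis unfolding B
    proof (rule packable_two_large)
      show "{v 0, v 1} \<inter> (S 0 \<union> S 1) = {}" using S' k by auto
      show "{s, s'} \<notin> E" if "s \<in> S 0 \<union> S 1" "s' \<in> S 0 \<union> S 1" for s s'
        by (rule ind) (use that k in \<open>auto simp: sets\<close>)
    qed (use k S(2,3) inj adj'(1)[of 0 1] adj'(1)[of 1 0] in
      \<open>auto simp: s_def\<close>)
  next
    assume k: "k = 3"
    have B: "B = {v 0, v 1, v 2} \<union> S 0 \<union> S 1 \<union> S 2" using k by (auto simp: B_def sets)
    show ?thesis unfolding B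
    proof (rule packable_three_large)
      show "{v 0, v 1, v 2} \<inter> (S 0 \<union> S 1 \<union> S 2) = {}" using S' k by auto
      show "{s, s'} \<notin> E" if "s \<in> S 0 \<union> S 1 \<union> S 2" "s' \<in> S 0 \<union> S 1 \<union> S 2" for s s'
        by (rule ind) (use that k in \<open>auto simp: sets\<close>)
    qed (use k S(2,3) inj adj'(1)[of 0 1] adj'(1)[of 0 2] adj'(1)[of 1 0] adj'(1)[of 1 2] adj'(1)[of 2 0] adj'(1)[of 2 1] in
      \<open>auto simp: s_def\<close>)
  next
    assume k: "k = 4"
    have B: "B = {v 0, v 1, v 2, v 3} \<union> S 0 \<union> S 1 \<union> S 2 \<union> S 3" using k by (auto simp: B_def sets)
    show ?thesis unfolding B
    proof (rule packable_four_large)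
      show "{v 0, v 1, v 2, v 3} \<inter> (S 0 \<union> S 1 \<union> S 2 \<union> S 3) = {}" using S' k by auto
      show "{s, s'} \<notin> E" if "s \<in> S 0 \<union> S 1 \<union> S 2 \<union> S 3" "s' \<in> S 0 \<union> S 1 \<union> S 2 \<union> S 3" for s s'
        by (rule ind) (use that k in \<open>auto simp: sets\<close>)
    qed (use k S(2,3) inj adj'(1)[of 0 1] adj'(1)[of 0 2] adj'(1)[of 0 3] adj'(1)[of 1 0] adj'(1)[of 1 2] adj'(1)[of 1 3] adj'(1)[of 2 0] adj'(1)[of 2 1] adj'(1)[of 2 3] adj'(1)[of 3 0] adj'(1)[of 3 1] adj'(1)[of 3 2] in
      \<open>auto simp: s_def\<close>)
  qed
  then show ?thesis
  proof (rule packable_extend[OF assms(1)])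
    show "B \<subseteq> V" using assms(3) Sv(2) by (auto simp: B_def)
    then have "finite B" using sgraphD(1)[OF assms(1)] finite_subset by blast
    have k0: "0 < k" "1 < k" using k by auto
    have fS: "finite (S i)" if "i < k" for i using S(2)[OF that] k by (intro card_ge_0_finite) (auto simp: s_def)
    have "card (S 0 \<union> S 1) = card (S 0) + card (S 1)"
      using fS[OF k0(1)] fS[OF k0(2)] S(3)[OF k0] by (intro card_Un_disjoint) auto
    moreover have "card (v ` {..<k} \<union> (S 0 \<union> S 1)) = card (v ` {..<k}) + card (S 0 \<union> S 1)"
      using fS[OF k0(1)] fS[OF k0(2)] Sv(1)[OF k0(1)] Sv(1)[OF k0(2)]
      by (intro card_Un_disjoint) auto
    moreover have "card (v ` {..<k} \<union> (S 0 \<union> S 1)) \<le> card B"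
      using k0 \<open>finite B\<close> by (intro card_mono) (auto simp: B_def)
    moreover have "card (v ` {..<k}) = k" using assms(2) by (simp add: card_image)
    moreover have "card (S 0) \<ge> 2" "card (S 1) \<ge> 2" using S(2)[OF k0(1)] S(2)[OF k0(2)] by (auto simp: s_def)
    ultimately show "5 \<le> card B" using k0 by linarith
    show "vdeg E x \<le> 1" if "x \<in> V - B" for x using that assms(4) by (auto simp: B_def)
  qed
qed

text \<open>The edges among non-neighbours of \<open>v\<close> form a matching, so the
  \<open>dense\<close> outcome, in which \<open>p\<close> has two neighbours, cannot occur.
  Neighbours of \<open>v\<close> are leaves at \<open>v\<close>, and two of them close the
  cycle.\<close>

lemma packable_one_large:
  assumes "sgraph V E" "v \<in> V" "\<And>x. x \<in> V - {v} \<Longrightarrow> vdeg E x \<le> 1"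
    and "2 \<le> vdeg E v" "vdeg E v + 5 \<le> card V"
  shows "packable V E"
proof -
  note fin = sgraphD(1,2)[OF assms(1)]
  define U0 where "U0 = {x \<in> V - {v}. {v, x} \<notin> E}"
  have "card U0 + vdeg E v + 1 = card V" using card_nonneighbours[OF assms(1,2)] by (simp add: U0_def)
  then have "4 \<le> card U0" using assms(5) by linarith
  then obtain U where U: "U \<subseteq> U0" "card U = 4" using obtain_subset_with_card_n by metis
  have "U \<subseteq> V" using U(1) by (auto simp: U0_def)
  then have UV: "U \<subseteq> V" "finite U" using fin(1) finite_subset by auto
  have U1: "vdeg E x \<le> 1" if "x \<in> U" for x using that U(1) assms(3) by (auto simp: U0_def)
  let ?E = "{e \<in> E. e \<subseteq> U}"
  have g: "sgraph U ?E" using assms(1) UV by (auto simp: sgraph_def)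
  have "2 * card ?E \<le> (\<Sum>x\<in>U. 1)"
    unfolding sum_vdeg[OF g, symmetric] using U1 vdeg_mono[OF fin(2), of ?E]
    by (intro sum_mono) (force intro: order_trans)
  then have "card ?E \<le> 3" using U(2) by simp
  with assms(1) UV(1) U(2) have "\<exists>a b c d. {a, b, c, d} \<subseteq> U \<and> nonadjacent_path E a b c d"
  proof (cases rule: nonadjacent_path_four)
    case (dense p q r)
    then have "q = r" using vdeg_le_1_unique[OF assms(1) U1[of p]] by simp
    then show ?thesis using dense by simp
  qed blast
  then obtain a b c d where abcd: "{a, b, c, d} \<subseteq> U" "nonadjacent_path E a b c d" by blast
  define N where "N = {y \<in> V. {v, y} \<in> E}"
  have "2 \<le> card N" using assms(4) by (simp add: N_def vdeg_eq_card_nbrs[OF assms(1)])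
  then obtain ys where "length ys = 2" and ys: "distinct ys" "set ys \<subseteq> N"
    using obtain_distinct_list by metis
  then obtain y1 y2 where y: "ys = [y1, y2]" by (auto simp: length_Suc_conv numeral_eq_Suc)
  have NU: "N \<inter> U = {}" "v \<notin> N" "v \<notin> U" "N \<subseteq> V"
    using U(1) sgraph_neq(1)[OF assms(1), of v v] by (auto simp: N_def U0_def)
  have Nv: "v \<in> e" if y: "y \<in> N" "e \<in> E" "y \<in> e" for y e
  proof -
    obtain z where z: "e = {y, z}" using sgraph_edgeE[OF assms(1) y(2,3)] by metis
    have "vdeg E y \<le> 1" using y(1) NU by (intro assms(3)) auto
    moreover have "{y, v} \<in> E" using y(1) by (simp add: N_def insert_commute)
    ultimately have "z = v" using vdeg_le_1_unique[OF assms(1)] y(2) z by metis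
    then show ?thesis using z by simp
  qed
  have core: "core_of E v a b c d"
    using abcd U(1) NU(3) by (auto simp: core_of_def U0_def)
  have yy: "y1 \<in> N" "y2 \<in> N" "y1 \<noteq> y2" using ys y by auto
  have "packable {a, b, c, d, v, y1, y2} E"
  proof (rule packable_core[OF core])
    show "{y1, y2} \<inter> {a, b, c, d, v} = {}" using yy abcd(1) NU by auto
  qed (use yy Nv in auto)
  then show ?thesis
  proof (rule packable_extend[OF assms(1)])
    show "{a, b, c, d, v, y1, y2} \<subseteq> V" using abcd(1) UV(1) assms(2) yy NU(4) by auto
    have "card {a, b, c, d, v} = 5" using core by (auto simp: core_of_def nonadjacent_path_def)
    moreover have "card {a, b, c, d, v} \<le> card {a, b, c, d, v, y1, y2}" by (intro card_mono) auto
    ultimately show "5 \<le> card {a, b, c, d, v, y1, y2}" by simp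
  qed (use assms(3) in auto)
qed

text \<open>Discarding one end of each edge leaves at least half of the vertices. These are
  independent, and ten vertices yield the five needed for extension.\<close>

lemma packable_matching:
  assumes "sgraph V E" "\<And>x. x \<in> V \<Longrightarrow> vdeg E x \<le> 1" "card V \<ge> 10"
  shows "packable V E"
proof -
  obtain F where F: "F \<subseteq> V" "\<And>e. e \<in> E \<Longrightarrow> \<not> e \<subseteq> F" "card V \<le> card F + card {e \<in> E. e \<subseteq> V}"
    using exists_independent[OF assms(1) sgraphD(1)[OF assms(1)]] by blast
  have "{e \<in> E. e \<subseteq> V} = E" using sgraphD(3)[OF assms(1)] by blast
  moreover have "2 * card E \<le> (\<Sum>x\<in>V. 1)"
    unfolding sum_vdeg[OF assms(1), symmetric] using assms(2) by (intro sum_mono)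
  ultimately have "card F \<ge> 5" using F(3) assms(3) by simp
  moreover have "finite F" using F(1) sgraphD(1)[OF assms(1)] finite_subset by blast
  then have "packable F E" using F(2) by (intro packable_independent)
  ultimately show ?thesis using packable_extend[OF assms(1) _ F(1)] assms(2) by blast
qed

text \<open>
  The bound on the number of edges drops by two per vertex, so vertices of degree at least two can be
  deleted as long as they can be inserted again; what remains has at most four vertices of degree at
  least two, apart from leaves, isolated edges and isolated vertices.
\<close>

lemma packable_sparse:
  assumes "sgraph V E" "card V \<le> 18" "card E + 20 \<le> 2 * card V" "\<And>x. x \<in> V \<Longrightarrow> vdeg E x \<le> 11"
  shows "packable V E"
  using assms
proof (induction "card V" arbitrary: V E rule: less_induct)
  case less
  note fin = sgraphD(1,2)[OF less.prems(1)]
  have n10: "10 \<le> card V" using less.prems(3) by simp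
  let ?W = "{w \<in> V. vdeg E w = 0}"
  have "4 \<le> card ?W \<or> card ?W \<le> 3" by linarith
  then consider "4 \<le> card ?W" | x where "x \<in> V" "2 \<le> vdeg E x" "4 * vdeg E x < card V - 1"
    | "card ?W \<le> 3" "\<And>x. x \<in> V \<Longrightarrow> 2 \<le> vdeg E x \<Longrightarrow> card V - 1 \<le> 4 * vdeg E x"
    using leI by blast
  then show ?case
  proof cases
    case 1
    have "card E + 2 \<le> card V" using less.prems(2,3) by linarith
    then show ?thesis using packable_dense[OF less.prems(1) n10] less.prems(3) 1 by blast
  next
    case (2 x)
    have c: "card (del_vertex E x) + vdeg E x = card E" "card (V - {x}) + 1 = card V"
      using card_del_vertex[OF fin(2)] card_Suc_Diff1[OF fin(1) 2(1)] by auto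
    have "packable (V - {x}) (del_vertex E x)"
    proof (rule less.hyps)
      show "vdeg (del_vertex E x) y \<le> 11" if "y \<in> V - {x}" for y
        using that less.prems(4)[of y] vdeg_mono[OF fin(2) del_vertex_subset, of x y] by auto
    qed (use c 2 less.prems sgraph_del_vertex in auto)
    then show ?thesis using 2 n10 by (intro packable_delete_step[OF less.prems(1), of x]) auto
  next
    case 3
    define L where "L = {x \<in> V. 2 \<le> vdeg E x}"
    have L: "L \<subseteq> V" "finite L" using fin by (auto simp: L_def)
    have R: "vdeg E x \<le> 1" if "x \<in> V - L" for x using that by (auto simp: L_def)
    have deg: "(card V + 2) div 4 \<le> vdeg E x" if "x \<in> L" for x
      using 3(2)[of x] that by (auto simp: L_def)
    have "card L * ((card V + 2) div 4) \<le> (\<Sum>x\<in>L. vdeg E x)"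
      using sum_bounded_below[of L "(card V + 2) div 4" "vdeg E"] deg by simp
    moreover have "card (V - L - ?W) * 1 \<le> (\<Sum>x\<in>V - L - ?W. vdeg E x)"
      using sum_bounded_below[of "V - L - ?W" 1 "vdeg E"] by fastforce
    moreover have "(\<Sum>x\<in>L. vdeg E x) + (\<Sum>x\<in>V - L - ?W. vdeg E x) \<le> (\<Sum>x\<in>V. vdeg E x)"
    proof -
      have "(\<Sum>x\<in>L. vdeg E x) + (\<Sum>x\<in>V - L - ?W. vdeg E x) = (\<Sum>x\<in>L \<union> (V - L - ?W). vdeg E x)"
        using fin L by (intro sum.union_disjoint[symmetric]) auto
      also have "\<dots> \<le> (\<Sum>x\<in>V. vdeg E x)" using fin L by (intro sum_mono2) auto
      finally show ?thesis .
    qed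
    moreover have "card V \<le> card L + card (V - L - ?W) + 3"
      using diff_card_le_card_Diff[of L V] diff_card_le_card_Diff[of ?W "V - L"] fin L 3(1) by simp
    ultimately have "card L * ((card V + 2) div 4) + card V \<le> 2 * card E + card L + 3"
      using sum_vdeg[OF less.prems(1)] by linarith
    from sparse_stuck_numeric[OF less.prems(2,3) this]
    have n: "card V \<ge> 13" and k: "card L = 0 \<or> card L = 1 \<or> card L = 2 \<and> card V \<ge> 15 \<or>
      card L = 3 \<and> card V \<ge> 16 \<or> card L = 4 \<and> card V \<ge> 17" by auto
    consider "L = {}" | v where "L = {v}" | "card L = 2 \<and> card V \<ge> 15 \<or>
      card L = 3 \<and> card V \<ge> 16 \<or> card L = 4 \<and> card V \<ge> 17"
      using k L(2) by (auto simp: card_1_singleton_iff)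
    then show ?thesis
    proof cases
      case 1
      then show ?thesis using R n10 by (intro packable_matching[OF less.prems(1)]) auto
    next
      case (2 v)
      have "vdeg E v \<le> card E" unfolding vdeg_def using fin(2) by (intro card_mono) auto
      moreover have "v \<in> V" "2 \<le> vdeg E v" using 2 by (auto simp: L_def)
      \<comment> \<open>The degree bound 11 gives this for at least 16 vertices, the edge bound
        \<open>2n - 20\<close> for at most 15.\<close>
      ultimately have "vdeg E v + 5 \<le> card V" using less.prems(3) less.prems(4)[of v] by linarith
      then show ?thesis
        using 2 R by (intro packable_one_large[OF less.prems(1), of v]) (auto simp: L_def)
    next
      case large: 3
      obtain v where v: "bij_betw v {0..<card L} L" using ex_bij_betw_nat_finite[OF L(2)] by blast
      then have v': "inj_on v {..<card L}" "v ` {..<card L} = L"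
        by (auto simp: bij_betw_def atLeast0LessThan)
      show ?thesis
      proof (rule packable_several_large[OF less.prems(1) v'(1)])
        show "card V - 1 \<le> 4 * vdeg E (v i)" if "i < card L" for i
          using that v'(2) 3(2)[of "v i"] by (auto simp: L_def)
      qed (use v' L R less.prems(2,3) large in auto)
    qed
  qed
qed

text \<open>Degree \<open>card V - 6\<close> is treated directly as well, although it is not
  exceptional. All remaining degrees are then at most \<open>card V - 7\<close>, so after one
  deletion the degree hypothesis still holds and the last hypothesis holds vacuously.\<close>

lemma packable_if_not_exceptional:
  assumes "sgraph V E" "card V \<ge> 18" "card E + 2 \<le> card V" "\<And>v. v \<in> V \<Longrightarrow> vdeg E v + 5 \<le> card V"
    and "\<And>v. v \<in> V \<Longrightarrow> vdeg E v + 5 = card V \<Longrightarrow> \<not> dense_nonneighbours V E v"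
  shows "packable V E"
  using assms
proof (induction "card V" arbitrary: V E rule: less_induct)
  case less
  note fin = sgraphD(1,2)[OF less.prems(1)]
  let ?W = "{w \<in> V. vdeg E w = 0}"
  show ?case
  proof (cases "4 \<le> card ?W")
    case True
    then show ?thesis using packable_dense[OF less.prems(1)] less.prems(2,3) by simp
  next
    case W: False
    show ?thesis
    proof (cases "\<exists>v\<in>V. card V \<le> vdeg E v + 6")
      case True
      then show ?thesis using packable_near_star[OF less.prems(1-3)] less.prems(4,5) by blast
    next
      case star: False
      show ?thesis
      proof (cases "card V = 18")
        case True
        have "vdeg E x \<le> 11" if "x \<in> V" for x using star that True by fastforce
        then show ?thesis using packable_sparse[OF less.prems(1)] less.prems(3) True by simp
      next
        case False
        \<comment> \<open>From 19 vertices on, a positive degree that blocks deletion is at least 5.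
          With at most three isolated vertices this would give
          \<open>5 * (n - 3) \<le> 2 * (n - 2)\<close>.\<close>
        have "\<exists>x\<in>V. 1 \<le> vdeg E x \<and> 4 * vdeg E x < card V - 1"
        proof (rule ccontr)
          assume "\<not> ?thesis"
          then have "5 \<le> vdeg E x" if "x \<in> V - ?W" for x
            using that less.prems(2) False by fastforce
          from sum_bounded_below[of "V - ?W" 5, OF this]
          have "card (V - ?W) * 5 \<le> (\<Sum>x\<in>V - ?W. vdeg E x)" by simp
          also have "\<dots> \<le> (\<Sum>x\<in>V. vdeg E x)" using fin by (intro sum_mono2) auto
          finally have "card (V - ?W) * 5 \<le> 2 * card E" by (simp add: sum_vdeg[OF less.prems(1)])
          moreover have "card V - card ?W \<le> card (V - ?W)"
            using fin by (intro diff_card_le_card_Diff) auto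
          ultimately show False using W less.prems(2,3) by linarith
        qed
        then obtain x where x: "x \<in> V" "1 \<le> vdeg E x" "4 * vdeg E x < card V - 1" by blast
        have c: "card (del_vertex E x) + vdeg E x = card E" "card (V - {x}) + 1 = card V"
          using card_del_vertex[OF fin(2)] card_Suc_Diff1[OF fin(1) x(1)] by auto
        have d: "vdeg (del_vertex E x) y + 6 \<le> card (V - {x})" if "y \<in> V - {x}" for y
          using that star c(2) vdeg_mono[OF fin(2) del_vertex_subset, of x y] by fastforce
        have "packable (V - {x}) (del_vertex E x)"
          using c d less.prems x False
          by (intro less.hyps) (force intro: sgraph_del_vertex)+
        then show ?thesis using x less.prems(2)
          by (intro packable_delete_step[OF less.prems(1), of x]) auto
      qed
    qed
  qed
qed

section \<open>Translation to digraphs\<close>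

lemma wf_digraph_with_proj:
  "parcs P \<subseteq> pverts P \<times> pverts P \<Longrightarrow> wf_digraph (with_proj P)"
  by unfold_locales auto

definition image_graph :: "('a \<Rightarrow> 'b) \<Rightarrow> 'a pair_pre_digraph \<Rightarrow> 'b pair_pre_digraph" where
  "image_graph f P = \<lparr>pverts = f ` pverts P, parcs = map_prod f f ` parcs P\<rparr>"

lemma image_graph_simps [simp]:
  "pverts (image_graph f P) = f ` pverts P" "parcs (image_graph f P) = map_prod f f ` parcs P"
  by (simp_all add: image_graph_def)

lemma digraph_iso_image_graph:
  assumes "parcs P \<subseteq> pverts P \<times> pverts P" "inj_on f (pverts P)"
  shows "digraph_iso (with_proj P) (with_proj (image_graph f P))"
proof -
  let ?h = "\<lparr>iso_verts = f, iso_arcs = map_prod f f, iso_head = snd, iso_tail = fst\<rparr>"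
  have "inj_on (map_prod f f) (pverts P \<times> pverts P)"
    using assms(2) by (intro map_prod_inj_on)
  then have "inj_on (map_prod f f) (parcs P)" using assms(1) by (rule inj_on_subset)
  then have "pre_digraph.digraph_isomorphism (with_proj P) ?h"
    using assms wf_digraph_with_proj[OF assms(1)] by (auto simp: pre_digraph.digraph_isomorphism_def)
  moreover have "with_proj (image_graph f P) = app_iso ?h (with_proj P)"
    by (simp add: app_iso_def with_proj_def)
  ultimately show ?thesis unfolding digraph_iso_def by blast
qed

lemma subgraph_with_projI:
  assumes "pverts H \<subseteq> pverts P" "parcs H \<subseteq> parcs P" "parcs P \<subseteq> pverts P \<times> pverts P"
    and "parcs H \<subseteq> pverts H \<times> pverts H"
  shows "subgraph (with_proj H) (with_proj P)"
  using assms wf_digraph_with_proj[of H] wf_digraph_with_proj[of P]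
  by (auto simp: subgraph_def compatible_def)

text \<open>The distance is an infimum of walk costs. Being below 3, it exceeds or equals no
  cost-free bound of 3: some walk costs less than 3, and since the cost is the length, that walk has
  at most two arcs.\<close>

lemma graph_dist_cycle_le_2:
  assumes "graph_dist (cycle_graph n) u v \<le> ereal (real 2)" "u < n" "v < n" "u \<noteq> v"
  shows "\<exists>d\<in>{1, 2}. v = (u + d) mod n \<or> u = (v + d) mod n"
proof -
  let ?C = "cycle_graph n"
  have wf: "wf_digraph (with_proj ?C)" by (rule wf_digraph_with_proj) (auto simp: cycle_graph_def)
  have "(INF p\<in>{p. pre_digraph.awalk (with_proj ?C) u p v}.
      ereal (wf_digraph.awalk_cost (\<lambda>_. 1) p)) < ereal 3"
    using assms(1) unfolding graph_dist_def wf_digraph.\<mu>_def[OF wf]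
    by (rule le_less_trans) simp
  then obtain p where p: "pre_digraph.awalk (with_proj ?C) u p v"
    "wf_digraph.awalk_cost (\<lambda>_. 1) p < 3" by (auto simp: INF_less_iff)
  have "wf_digraph.awalk_cost (\<lambda>_. 1) p = real (length p)"
    by (induction p) (auto simp: wf_digraph.awalk_cost_def[OF wf])
  then have len: "length p \<le> 2" using p(2) by linarith
  have w: "set p \<subseteq> parcs ?C" "pcas u p v"
    using p(1) by (auto simp: pre_digraph.awalk_def cas_with_proj_eq)
  have step: "y = (x + 1) mod n \<or> x = (y + 1) mod n" "x < n" "y < n" if "(x, y) \<in> parcs ?C" for x y
    using that by (auto simp: cycle_graph_def)
  have inj: "x = y" if "(x + 1) mod n = (y + 1) mod n" "x < n" "y < n" for x y
    using that by (auto simp: mod_Suc split: if_splits)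
  have two: "((x + 1) mod n + 1) mod n = (x + 2) mod n" for x
    by (simp add: mod_simps)
  consider "p = []" | e where "p = [e]" | e e' where "p = [e, e']"
    using len by (cases p; cases "tl p"; cases "tl (tl p)") auto
  then show ?thesis
  proof cases
    case 1
    then show ?thesis using w assms(4) by simp
  next
    case (2 e)
    then have "(u, v) \<in> parcs ?C" using w by (cases e) auto
    then show ?thesis using step by blast
  next
    case (3 e e')
    then obtain z where z: "(u, z) \<in> parcs ?C" "(z, v) \<in> parcs ?C"
      using w by (cases e; cases e') auto
    from step(1)[OF z(1)] step(1)[OF z(2)] show ?thesis
    proof (elim disjE)
      assume "z = (u + 1) mod n" "v = (z + 1) mod n"
      then have "v = (u + 2) mod n" using two by simp
      then show ?thesis by blast
    next
      assume "z = (u + 1) mod n" "z = (v + 1) mod n"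
      then show ?thesis using inj[of u v] assms(2-4) by simp
    next
      assume "u = (z + 1) mod n" "v = (z + 1) mod n"
      then show ?thesis using assms(4) by simp
    next
      assume "u = (z + 1) mod n" "z = (v + 1) mod n"
      then have "u = (v + 2) mod n" using two by simp
      then show ?thesis by blast
    qed
  qed
qed

section \<open>Missing edges of a graph and the exceptional graphs\<close>

definition nonedges :: "'a pair_pre_digraph \<Rightarrow> 'a set set" where
  "nonedges G = {{u, v} |u v. u \<in> pverts G \<and> v \<in> pverts G \<and> u \<noteq> v \<and> (u, v) \<notin> parcs G}"

context
  fixes G :: "'a pair_pre_digraph"
  assumes G: "pair_graph G"
begin

lemma parcs_sym: "(u, v) \<in> parcs G \<Longrightarrow> (v, u) \<in> parcs G"
proof -
  interpret pair_graph G by (rule G)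
  show "(u, v) \<in> parcs G \<Longrightarrow> (v, u) \<in> parcs G" using pair_sym_arcs
    by (auto simp: symmetric_def sym_def)
qed

lemma parcs_subset: "parcs G \<subseteq> pverts G \<times> pverts G"
proof -
  interpret pair_graph G by (rule G)
  show ?thesis using in_arcsD1 in_arcsD2 by auto
qed

lemma parcs_neq: "(u, v) \<in> parcs G \<Longrightarrow> u \<noteq> v"
proof -
  interpret pair_graph G by (rule G)
  show "(u, v) \<in> parcs G \<Longrightarrow> u \<noteq> v" using pair_no_loops by fastforce
qed

lemma finite_pverts: "finite (pverts G)"
proof -
  interpret pair_graph G by (rule G)
  show ?thesis by (rule pair_finite_verts)
qed

lemma sgraph_nonedges: "sgraph (pverts G) (nonedges G)"
  using finite_pverts by (auto simp: sgraph_def nonedges_def)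

lemma nonedges_iff:
  "{u, v} \<in> nonedges G \<longleftrightarrow> u \<in> pverts G \<and> v \<in> pverts G \<and> u \<noteq> v \<and> (u, v) \<notin> parcs G"
  using parcs_sym by (auto simp: nonedges_def doubleton_eq_iff)

lemma card_nonedges: "card (nonedges G) + card (edges G) = card (pverts G) choose 2"
proof -
  let ?P = "{e. e \<subseteq> pverts G \<and> card e = 2}"
  have "?P = nonedges G \<union> edges G"
    using parcs_subset parcs_neq by (fastforce simp: nonedges_def edges_def card_2_iff)
  moreover have "nonedges G \<inter> edges G = {}"
    using parcs_sym by (auto simp: nonedges_def edges_def doubleton_eq_iff)
  moreover have "finite ?P" using finite_pverts by simp
  ultimately have "card ?P = card (nonedges G) + card (edges G)"
    by (metis card_Un_disjoint finite_Un)
  then show ?thesis using n_subsets[OF finite_pverts] by simp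
qed

lemma contains_power_of_ham_cycle_if_packable:
  assumes "packable (pverts G) (nonedges G)"
  shows "contains_power_of_ham_cycle 2 G"
proof -
  obtain xs where xs: "distinct xs" "set xs = pverts G" "sq_edges xs \<inter> nonedges G = {}"
    using assms by (auto simp: packable_def)
  define n where "n = length xs"
  have n: "card (pverts G) = n" using xs distinct_card n_def by metis
  let ?C = "graph_power 2 (cycle_graph n)"
  let ?f = "\<lambda>i. xs ! i"
  have C: "pverts ?C = {..<n}" "parcs ?C \<subseteq> pverts ?C \<times> pverts ?C"
    by (auto simp: graph_power_def cycle_graph_def)
  have f: "?f ` {..<n} = pverts G"
    using xs(2) by (auto simp: n_def set_conv_nth)
  have inj: "inj_on ?f {..<n}" using xs(1) by (auto simp: inj_on_def n_def nth_eq_iff_index_eq)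
  have arcs: "(?f i, ?f j) \<in> parcs G" if "(i, j) \<in> parcs ?C" for i j
  proof -
    have ij: "i < n" "j < n" "i \<noteq> j" "graph_dist (cycle_graph n) i j \<le> ereal (real 2)"
      using that by (auto simp: graph_power_def cycle_graph_def)
    then obtain d where "d \<in> {1, 2}" "j = (i + d) mod n \<or> i = (j + d) mod n"
      using graph_dist_cycle_le_2[OF ij(4,1,2,3)] by blast
    then have "{?f i, ?f j} \<in> sq_edges xs"
      using sq_edgesI[of i xs d "{?f i, ?f j}"] sq_edgesI[of j xs d "{?f i, ?f j}"] ij
      by (auto simp: n_def insert_commute)
    then have "{?f i, ?f j} \<notin> nonedges G" using xs(3) by blast
    moreover have "?f i \<noteq> ?f j" using ij inj by (auto dest: inj_onD)
    ultimately show ?thesis using f ij by (auto simp: nonedges_iff)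
  qed
  have "subgraph (with_proj (image_graph ?f ?C)) (with_proj G)"
  proof (rule subgraph_with_projI)
    show "parcs (image_graph ?f ?C) \<subseteq> parcs G" using arcs by auto
    show "parcs (image_graph ?f ?C) \<subseteq> pverts (image_graph ?f ?C) \<times> pverts (image_graph ?f ?C)"
      using C(2) by auto
  qed (use C f parcs_subset in auto)
  then have "spanning (with_proj (image_graph ?f ?C)) (with_proj G)"
    using C f by (simp add: spanning_def)
  moreover have "digraph_iso (with_proj ?C) (with_proj (image_graph ?f ?C))"
    using C inj by (intro digraph_iso_image_graph) auto
  ultimately show ?thesis unfolding contains_power_of_ham_cycle_def n by blast
qed

text \<open>A copy of \<open>F\<close> among the missing edges suffices. A bijection
  \<open>h\<close> onto \<open>{..<?n}\<close> carries this copy to the one deleted from the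
  complete graph, and carries \<open>G\<close> into what is left.\<close>

lemma subgraph_of_complete_minus:
  assumes "parcs F \<subseteq> pverts F \<times> pverts F" "\<And>x y. (x, y) \<in> parcs F \<Longrightarrow> x \<noteq> y"
    and "inj_on g (pverts F)" "g ` pverts F \<subseteq> pverts G"
    and "\<And>x y. (x, y) \<in> parcs F \<Longrightarrow> {g x, g y} \<in> nonedges G"
  shows "\<exists>M. complete_minus (card (pverts G)) F M \<and> subgraph_up_to_iso G M"
proof -
  let ?n = "card (pverts G)"
  obtain h where h: "bij_betw h (pverts G) {..<?n}"
    using finite_pverts bij_betw_iff_card[of "pverts G" "{..<?n}"] by auto
  have hi: "inj_on h (pverts G)" "h ` pverts G = {..<?n}" using h by (auto simp: bij_betw_def)
  let ?F = "image_graph (h \<circ> g) F"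
  let ?M = "delete_edges (complete_graph ?n) ?F"
  have hg: "inj_on (h \<circ> g) (pverts F)"
    using assms(3,4) hi(1) by (intro comp_inj_on) (auto intro: inj_on_subset)
  have lt: "h (g x) < ?n" if "x \<in> pverts F" for x using that assms(4) hi(2) by blast
  have "subgraph (with_proj ?F) (with_proj (complete_graph ?n))"
  proof (rule subgraph_with_projI)
    have "(h (g x), h (g y)) \<in> parcs (complete_graph ?n)" if xy: "(x, y) \<in> parcs F" for x y
    proof -
      have x: "x \<in> pverts F" "y \<in> pverts F" "x \<noteq> y" using xy assms(1,2) by auto
      then have "h (g x) \<noteq> h (g y)" using inj_onD[OF hg, of x y] by auto
      then show ?thesis using lt x by (simp add: complete_on_def)
    qed
    then show "parcs ?F \<subseteq> parcs (complete_graph ?n)" by auto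
    show "parcs ?F \<subseteq> pverts ?F \<times> pverts ?F" using assms(1) by auto
    show "pverts ?F \<subseteq> pverts (complete_graph ?n)" using lt by (auto simp: complete_on_def)
  qed (auto simp: complete_on_def)
  moreover have "digraph_iso (with_proj F) (with_proj ?F)"
    using assms(1) hg by (rule digraph_iso_image_graph)
  ultimately have 1: "complete_minus ?n F ?M" unfolding complete_minus_def by blast
  have "subgraph (with_proj (image_graph h G)) (with_proj ?M)"
  proof (rule subgraph_with_projI)
    have "(h x, h y) \<in> parcs ?M" if xy: "(x, y) \<in> parcs G" for x y
    proof -
      have V: "x \<in> pverts G" "y \<in> pverts G" "x \<noteq> y" using xy parcs_subset parcs_neq by auto
      have "(h x, h y) \<notin> parcs ?F"
      proof
        assume "(h x, h y) \<in> parcs ?F"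
        then obtain a b where ab: "(a, b) \<in> parcs F" "h x = h (g a)" "h y = h (g b)" by auto
        then have "g a \<in> pverts G" "g b \<in> pverts G" using assms(1,4) by auto
        then have "x = g a" "y = g b" using V ab inj_onD[OF hi(1)] by auto
        then show False using assms(5)[OF ab(1)] xy by (simp add: nonedges_iff)
      qed
      moreover have "h x \<noteq> h y" using V inj_onD[OF hi(1)] by blast
      moreover have "h x < ?n" "h y < ?n" using V hi(2) by auto
      ultimately show ?thesis by (simp add: delete_edges_def complete_on_def)
    qed
    then show "parcs (image_graph h G) \<subseteq> parcs ?M" by auto
    show "pverts (image_graph h G) \<subseteq> pverts ?M"
      using hi(2) by (simp add: delete_edges_def complete_on_def)
    show "parcs ?M \<subseteq> pverts ?M \<times> pverts ?M" by (auto simp: delete_edges_def complete_on_def)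
    show "parcs (image_graph h G) \<subseteq> pverts (image_graph h G) \<times> pverts (image_graph h G)"
      using parcs_subset by auto
  qed
  moreover have "digraph_iso (with_proj G) (with_proj (image_graph h G))"
    using parcs_subset hi(1) by (rule digraph_iso_image_graph)
  ultimately have "subgraph_up_to_iso G ?M" unfolding subgraph_up_to_iso_def by blast
  then show ?thesis using 1 by blast
qed

lemma subgraph_of_complete_minus_star:
  assumes "v \<in> pverts G" "k \<le> vdeg (nonedges G) v"
  shows "\<exists>M. complete_minus (card (pverts G)) (star_graph (Suc k)) M \<and> subgraph_up_to_iso G M"
proof -
  let ?N = "{y \<in> pverts G. {v, y} \<in> nonedges G}"
  obtain ys where ys: "length ys = k" "distinct ys" "set ys \<subseteq> ?N"
    using obtain_distinct_list[of k ?N] assms(2) vdeg_eq_card_nbrs[OF sgraph_nonedges] by metis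
  have d: "distinct (v # ys)" using ys sgraph_neq(1)[OF sgraph_nonedges, of v v] by auto
  have y: "{v, ys ! i} \<in> nonedges G" "ys ! i \<in> pverts G" if "i < k" for i
    using ys that nth_mem by (metis (mono_tags, lifting) mem_Collect_eq subsetD)+
  show ?thesis
  proof (rule subgraph_of_complete_minus[where g = "\<lambda>i. (v # ys) ! i"])
    show "inj_on (\<lambda>i. (v # ys) ! i) (pverts (star_graph (Suc k)))"
      using d ys(1) by (intro inj_on_nth) (auto simp: star_graph_def)
    show "{(v # ys) ! i, (v # ys) ! j} \<in> nonedges G" if "(i, j) \<in> parcs (star_graph (Suc k))" for i j
      using that y by (cases i; cases j) (auto simp: star_graph_def insert_commute)
    show "(\<lambda>i. (v # ys) ! i) ` pverts (star_graph (Suc k)) \<subseteq> pverts G"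
      using y(2) assms(1) by (auto simp: star_graph_def nth_Cons split: nat.splits)
  qed (auto simp: star_graph_def)
qed

text \<open>Since \<open>g\<close> avoids \<open>v\<close> and its neighbours in
  \<open>nonedges G\<close>, the copy of \<open>P\<close> is disjoint from the star whichever leaves
  are chosen.\<close>

lemma subgraph_of_complete_minus_star_union:
  assumes "v \<in> pverts G" "k \<le> vdeg (nonedges G) v"
    and "parcs P \<subseteq> pverts P \<times> pverts P" "\<And>x y. (x, y) \<in> parcs P \<Longrightarrow> x \<noteq> y"
    and "inj_on g (pverts P)" "g ` pverts P \<subseteq> pverts G - {v}"
    and "\<And>x. x \<in> pverts P \<Longrightarrow> {v, g x} \<notin> nonedges G"
    and "\<And>x y. (x, y) \<in> parcs P \<Longrightarrow> {g x, g y} \<in> nonedges G"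
  shows "\<exists>M. complete_minus (card (pverts G)) (disjoint_union (star_graph (Suc k)) P) M \<and>
    subgraph_up_to_iso G M"
proof -
  let ?N = "{y \<in> pverts G. {v, y} \<in> nonedges G}"
  obtain ys where ys: "length ys = k" "distinct ys" "set ys \<subseteq> ?N"
    using obtain_distinct_list[of k ?N] assms(2) vdeg_eq_card_nbrs[OF sgraph_nonedges] by metis
  have d: "distinct (v # ys)" using ys sgraph_neq(1)[OF sgraph_nonedges, of v v] by auto
  have y: "{v, ys ! i} \<in> nonedges G" "ys ! i \<in> pverts G" if "i < k" for i
    using ys that nth_mem by (metis (mono_tags, lifting) mem_Collect_eq subsetD)+
  let ?s = "\<lambda>i. (v # ys) ! i"
  have s: "inj_on ?s {..<Suc k}" using d ys(1) by (intro inj_on_nth) auto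
  have sv: "?s i = v \<or> {v, ?s i} \<in> nonedges G" "?s i \<in> pverts G" if "i < Suc k" for i
    using that y assms(1) by (cases i; auto)+
  have sg: "?s i \<noteq> g x" if "i < Suc k" "x \<in> pverts P" for i x
    using sv(1)[OF that(1)] assms(6,7) that(2) by (metis DiffE imageI singletonI subsetD)
  show ?thesis
  proof (rule subgraph_of_complete_minus[where g = "case_sum ?s g"])
    show "inj_on (case_sum ?s g) (pverts (disjoint_union (star_graph (Suc k)) P))"
    proof (rule inj_onI)
      fix a b assume "a \<in> pverts (disjoint_union (star_graph (Suc k)) P)"
        "b \<in> pverts (disjoint_union (star_graph (Suc k)) P)" "case_sum ?s g a = case_sum ?s g b"
      then show "a = b" using inj_onD[OF s] inj_onD[OF assms(5)] sg
        by (cases a; cases b) (auto simp: disjoint_union_def star_graph_def, metis+)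
    qed
    show "{case_sum ?s g a, case_sum ?s g b} \<in> nonedges G"
      if "(a, b) \<in> parcs (disjoint_union (star_graph (Suc k)) P)" for a b
    proof -
      consider i j where "a = Inl i" "b = Inl j" "(i, j) \<in> parcs (star_graph (Suc k))"
        | i j where "a = Inr i" "b = Inr j" "(i, j) \<in> parcs P"
        using \<open>(a, b) \<in> _\<close> by (auto simp: disjoint_union_def)
      then show ?thesis
      proof cases
        case (1 i j)
        then show ?thesis using y by (cases i; cases j) (auto simp: star_graph_def insert_commute)
      next
        case (2 i j)
        then show ?thesis using assms(8) by simp
      qed
    qed
    show "case_sum ?s g ` pverts (disjoint_union (star_graph (Suc k)) P) \<subseteq> pverts G"
      using sv(2) assms(6) by (auto simp: disjoint_union_def star_graph_def)
  qed (use assms(3,4) in \<open>auto simp: disjoint_union_def star_graph_def\<close>)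
qed

end

theorem theorem1p1:
  fixes G :: "'a pair_pre_digraph" and n :: nat
  assumes "pair_graph G"
    and "card (pverts G) = n"
    and "n \<ge> 18"
    and "real (card (edges G)) > ((real n)\<^sup>2 - 3 * real n + 3) / 2"
  shows "contains_power_of_ham_cycle 2 G \<or>
    (\<exists>M. complete_minus n (star_graph (n - 3)) M \<and> subgraph_up_to_iso G M) \<or>
    (\<exists>M. complete_minus n (disjoint_union (star_graph (n - 4)) (star_graph 4)) M \<and>
      subgraph_up_to_iso G M) \<or>
    (\<exists>M. complete_minus n (disjoint_union (star_graph (n - 4)) (complete_graph 3)) M \<and>
      subgraph_up_to_iso G M)"
proof -
  note G = assms(1)
  let ?V = "pverts G" and ?E = "nonedges G"
  have "real (2 * (n choose 2)) = real (n * (n - 1))"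
  proof -
    have "even (n * (n - 1))" by (cases "even n") auto
    then show ?thesis unfolding choose_two by simp
  qed
  then have "2 * real (n choose 2) = real n * (real n - 1)"
    using assms(3) by (simp add: of_nat_diff)
  moreover have "real (card ?E) + real (card (edges G)) = real (n choose 2)"
    using card_nonedges[OF G] assms(2) by (metis of_nat_add)
  \<comment> \<open>This is \<open>n * (n - 1) - (n^2 - 3 * n + 3) = 2 * n - 3\<close>; integrality
    then gives at most \<open>n - 2\<close> missing edges.\<close>
  ultimately have "2 * real (card ?E) < 2 * real n - 3"
    using assms(4) by (simp add: power2_eq_square field_simps)
  then have m: "card ?E + 2 \<le> n" by linarith
  note g = sgraph_nonedges[OF G]
  show ?thesis
  proof (cases "\<exists>v\<in>?V. n < vdeg ?E v + 5")
    case True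
    then obtain v where v: "v \<in> ?V" "n - 4 \<le> vdeg ?E v" by auto
    \<comment> \<open>A star is indexed by its number of vertices, one more than the degree of its
      centre.\<close>
    moreover have "Suc (n - 4) = n - 3" using assms(3) by simp
    ultimately show ?thesis using subgraph_of_complete_minus_star[OF G v] assms(2) by simp
  next
    case small: False
    show ?thesis
    proof (cases "\<exists>v\<in>?V. vdeg ?E v + 5 = n \<and> dense_nonneighbours ?V ?E v")
      case False
      then have "packable ?V ?E"
        using small m assms(2,3) by (intro packable_if_not_exceptional[OF g]) (auto simp: not_less)
      then show ?thesis using contains_power_of_ham_cycle_if_packable[OF G] by blast
    next
      case True
      then obtain v p q r where v: "v \<in> ?V" "vdeg ?E v + 5 = n"
        and pqr: "{p, q, r} \<subseteq> ?V" "distinct [v, p, q, r]"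
          "{v, p} \<notin> ?E" "{v, q} \<notin> ?E" "{v, r} \<notin> ?E" "{p, q} \<in> ?E" "{p, r} \<in> ?E"
        and qr: "{q, r} \<in> ?E \<or> (\<exists>s\<in>?V. s \<notin> {v, p, q, r} \<and> {v, s} \<notin> ?E \<and> {p, s} \<in> ?E)"
        unfolding dense_nonneighbours_def by blast
      have k: "n - 5 \<le> vdeg ?E v" "Suc (n - 5) = n - 4" using v(2) assms(3) by auto
      have less3: "i < 3 \<longleftrightarrow> i = 0 \<or> i = 1 \<or> i = 2" and less4: "i < 4 \<longleftrightarrow> i = 0 \<or> i = 1 \<or> i = 2 \<or> i = 3"
        for i :: nat by auto
      from qr show ?thesis
      proof (elim disjE bexE conjE)
        assume qr: "{q, r} \<in> ?E"
        let ?g = "\<lambda>i. [p, q, r] ! i"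
        have "\<exists>M. complete_minus (card ?V) (disjoint_union (star_graph (Suc (n - 5))) (complete_graph 3)) M \<and>
          subgraph_up_to_iso G M"
        proof (rule subgraph_of_complete_minus_star_union[OF G v(1) k(1), where g = ?g])
          show "inj_on ?g (pverts (complete_graph 3))"
            using pqr(2) by (intro inj_on_nth) (auto simp: complete_on_def)
          show "{?g x, ?g y} \<in> ?E" if "(x, y) \<in> parcs (complete_graph 3)" for x y
            using that pqr(6,7) qr by (auto simp: complete_on_def less3 insert_commute)
        qed (use pqr in \<open>auto simp: complete_on_def less3\<close>)
        then show ?thesis using k(2) assms(2) by simp
      next
        fix s assume s: "s \<in> ?V" "s \<notin> {v, p, q, r}" "{v, s} \<notin> ?E" "{p, s} \<in> ?E"
        \<comment> \<open>\<open>p\<close> comes first because \<open>star_graph\<close> has its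
          centre at 0.\<close>
        let ?g = "\<lambda>i. [p, q, r, s] ! i"
        have "\<exists>M. complete_minus (card ?V) (disjoint_union (star_graph (Suc (n - 5))) (star_graph 4)) M \<and>
          subgraph_up_to_iso G M"
        proof (rule subgraph_of_complete_minus_star_union[OF G v(1) k(1), where g = ?g])
          show "inj_on ?g (pverts (star_graph 4))"
            using pqr(2) s(2) by (intro inj_on_nth) (auto simp: star_graph_def)
          show "{?g x, ?g y} \<in> ?E" if "(x, y) \<in> parcs (star_graph 4)" for x y
            using that pqr(6,7) s(4) by (auto simp: star_graph_def less4 insert_commute)
        qed (use pqr s in \<open>auto simp: star_graph_def less4\<close>)
        then show ?thesis using k(2) assms(2) by simp
      qed
    qed
  qed
qed

end
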